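(* Let $\varphi\in H^2(\Gamma_w)$ with $\varphi\neq 0$ and $\varphi(D)\cap D\neq\emptyset$, and let $\Omega_\varphi=\{w\in D:|\varphi(w)|<1\}$. On $N_\varphi$: (i) $\overline{\Omega_\varphi}\subset\sigma(S_w)$. (ii) $S_w-\alpha I$ is Fredholm for every $\alpha\in\Omega_\varphi$, and $\mathrm{ind}(S_w-\alpha I)=-1$.
   Context: $D$ is the open unit disk, $\Gamma$ the unit circle. $H^2(\Gamma^2)$ is the Hardy space on the torus $\Gamma^2$, identified with holomorphic functions on $D^2$, with coordinate functions $z,w$; $H^2(\Gamma_w)$ is the Hardy space in the variable $w$. For $\varphi\in H^2(\Gamma_w)$, $M_\varphi=[z-\varphi]$ is the closure of $(z-\varphi(w))H^\infty(\Gamma^2)$ in $H^2(\Gamma^2)$, and $N_\varphi=H^2(\Gamma^2)\ominus M_\varphi$ (which is nonzero if and only if $\varphi(D)\cap D\neq\emptyset$). $S_w$ is the compression of multiplication by $w$: $S_wf=P_{N_\varphi}(wf)$ for $f\in N_\varphi$, with $P_{N_\varphi}$ the orthogonal projection onto $N_\varphi$. $\sigma$ denotes the spectrum, and the index is $\mathrm{ind}(A)=\dim\ker A-\dim\ker A^*$. *)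

theory Defs
  imports "HOL-Complex_Analysis.Complex_Analysis"
begin

abbreviation unit_disc :: "complex set"
  where "unit_disc \<equiv> ball 0 1"

definition H2_disc :: "(complex \<Rightarrow> complex) set"
  where "H2_disc = {\<phi>. \<exists>a :: nat \<Rightarrow> complex. summable (\<lambda>n. (cmod (a n))\<^sup>2) \<and>
           (\<forall>w\<in>unit_disc. (\<lambda>n. a n * w ^ n) sums \<phi> w)}"

section \<open>The Hardy space on the torus\<close>

definition bidisc_series :: "(complex \<times> complex \<Rightarrow> complex) \<Rightarrow> (nat \<times> nat \<Rightarrow> complex) \<Rightarrow> bool"
  where "bidisc_series f a \<longleftrightarrow> (\<forall>z\<in>unit_disc. \<forall>w\<in>unit_disc.
           ((\<lambda>(m, n). a (m, n) * z ^ m * w ^ n) has_sum f (z, w)) UNIV)"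

lemma bidisc_series_const_0: "bidisc_series (\<lambda>_. 0) (\<lambda>_. 0)"
  by (simp add: bidisc_series_def case_prod_unfold)

text \<open>The Hardy space on the torus, identified with a space of holomorphic functions on the
  bidisc: the Fourier coefficients of the boundary function are the Taylor coefficients at the
  origin, so membership means that the latter are square summable.  Functions are normalised to
  vanish off the open bidisc, so that equality in the type is equality on the bidisc.\<close>

typedef hardy2 =
  "{f :: complex \<times> complex \<Rightarrow> complex.
      (\<exists>a. (\<lambda>k. (cmod (a k))\<^sup>2) summable_on UNIV \<and> bidisc_series f a) \<and>
      (\<forall>p. p \<notin> unit_disc \<times> unit_disc \<longrightarrow> f p = 0)}"
  morphisms hfun Abs_hardy2
  by (rule exI[of _ "\<lambda>_. 0"]) (auto intro!: exI[of _ "\<lambda>_. 0"] bidisc_series_const_0)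

setup_lifting type_definition_hardy2

lemma powser_coeffs_zero:
  fixes a :: "nat \<Rightarrow> complex"
  assumes "\<And>w. w \<in> unit_disc \<Longrightarrow> (\<lambda>n. a n * w ^ n) sums 0"
  shows "a n = 0"
proof (rule ccontr)
  assume n: "a n \<noteq> 0"
  have a0: "a 0 = 0"
    using assms[of 0] by simp
  hence "n > 0" using n by (cases n) auto
  show False
  proof (rule powser_0_nonzero[of 1 0 a "\<lambda>_. 0" n])
    show "(\<lambda>n. a n * (x - 0) ^ n) sums 0" if "norm (x - 0) < 1" for x
      using assms[of x] that by simp
    fix s :: real assume s: "0 < s" "\<And>z. z \<in> cball (0::complex) s - {0} \<Longrightarrow> (0::complex) \<noteq> 0"
    have "complex_of_real s \<in> cball 0 s - {0}" using \<open>0 < s\<close> by simp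
    thus False using s(2) by blast
  qed (fact n \<open>n > 0\<close> refl zero_less_one)+
qed

lemma bidisc_series_zero:
  assumes "bidisc_series f a" "\<And>p. p \<in> unit_disc \<times> unit_disc \<Longrightarrow> f p = 0"
  shows "a k = 0"
proof -
  obtain m n where k: "k = (m, n)" by (cases k)
  have hs: "((\<lambda>(m, n). a (m, n) * z ^ m * w ^ n) has_sum 0) UNIV"
    if "z \<in> unit_disc" "w \<in> unit_disc" for z w
  proof -
    have "f (z, w) = 0" using assms(2)[of "(z, w)"] that by simp
    thus ?thesis using assms(1) that unfolding bidisc_series_def by fastforce
  qed
  have summ: "(\<lambda>n. a (m, n) * w ^ n) summable_on UNIV" if w: "w \<in> unit_disc" for m w
  proof -
    have "(\<lambda>(m, n). a (m, n) * (1/2) ^ m * w ^ n) summable_on (SIGMA x:UNIV. UNIV)"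
      using hs[of "1/2" w] w by (auto simp: summable_on_def)
    from summable_on_SigmaD1[OF this, of m]
    have "(\<lambda>n. (1/2) ^ m * (a (m, n) * w ^ n)) summable_on UNIV"
      by (simp add: mult_ac)
    from summable_on_cmult_right[OF this, of "2 ^ m"] show ?thesis
      by (simp add: mult.assoc[symmetric] power_mult_distrib[symmetric] del: power_one_over)
  qed
  have row: "infsum (\<lambda>n. a (m, n) * w ^ n) UNIV = 0" if w: "w \<in> unit_disc" for m w
  proof (rule powser_coeffs_zero)
    fix z :: complex assume z: "z \<in> unit_disc"
    have "((\<lambda>m. infsum (\<lambda>n. a (m, n) * w ^ n) UNIV * z ^ m) has_sum 0) UNIV"
    proof (rule has_sum_SigmaD)
      show "((\<lambda>(m, n). a (m, n) * z ^ m * w ^ n) has_sum 0) (SIGMA x:UNIV. UNIV)"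
        using hs[OF z w] by simp
      fix m
      have "((\<lambda>n. a (m, n) * w ^ n * z ^ m) has_sum infsum (\<lambda>n. a (m, n) * w ^ n) UNIV * z ^ m) UNIV"
        by (intro has_sum_cmult_left has_sum_infsum summ w)
      thus "((\<lambda>n. case (m, n) of (m, n) \<Rightarrow> a (m, n) * z ^ m * w ^ n) has_sum
              infsum (\<lambda>n. a (m, n) * w ^ n) UNIV * z ^ m) UNIV"
        by (simp add: mult_ac)
    qed
    thus "(\<lambda>m. infsum (\<lambda>n. a (m, n) * w ^ n) UNIV * z ^ m) sums 0"
      by (rule has_sum_imp_sums)
  qed
  have "a (m, n) = 0"
  proof (rule powser_coeffs_zero)
    fix w :: complex assume w: "w \<in> unit_disc"
    show "(\<lambda>n. a (m, n) * w ^ n) sums 0"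
      using has_sum_infsum[OF summ[OF w, of m]] row[OF w, of m] by (metis has_sum_imp_sums)
  qed
  thus ?thesis by (simp add: k)
qed

lemma bidisc_series_add:
  assumes "bidisc_series f a" "bidisc_series g b"
  shows "bidisc_series (\<lambda>p. f p + g p) (\<lambda>k. a k + b k)"
  unfolding bidisc_series_def
proof (intro ballI)
  fix z w :: complex assume "z \<in> unit_disc" "w \<in> unit_disc"
  with assms have "((\<lambda>k. (case k of (m, n) \<Rightarrow> a (m, n) * z ^ m * w ^ n) +
      (case k of (m, n) \<Rightarrow> b (m, n) * z ^ m * w ^ n)) has_sum f (z, w) + g (z, w)) UNIV"
    unfolding bidisc_series_def by (intro has_sum_add) auto
  thus "((\<lambda>(m, n). (a (m, n) + b (m, n)) * z ^ m * w ^ n) has_sum f (z, w) + g (z, w)) UNIV"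
    by (simp add: case_prod_unfold algebra_simps)
qed

lemma bidisc_series_cmult:
  assumes "bidisc_series f a"
  shows "bidisc_series (\<lambda>p. c * f p) (\<lambda>k. c * a k)"
  unfolding bidisc_series_def
proof (intro ballI)
  fix z w :: complex assume "z \<in> unit_disc" "w \<in> unit_disc"
  with assms have "((\<lambda>k. c * (case k of (m, n) \<Rightarrow> a (m, n) * z ^ m * w ^ n)) has_sum c * f (z, w)) UNIV"
    unfolding bidisc_series_def by (intro has_sum_cmult_right) auto
  thus "((\<lambda>(m, n). c * a (m, n) * z ^ m * w ^ n) has_sum c * f (z, w)) UNIV"
    by (simp add: case_prod_unfold algebra_simps)
qed

lemma bidisc_series_unique:
  assumes "bidisc_series f a" "bidisc_series f b"
  shows "a = b"
proof
  fix k
  have "bidisc_series (\<lambda>p. f p + (-1) * f p) (\<lambda>k. a k + (-1) * b k)"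
    by (intro bidisc_series_add bidisc_series_cmult assms)
  from bidisc_series_zero[OF this, of k] show "a k = b k" by simp
qed

lemma square_summable_add:
  fixes a b :: "'k \<Rightarrow> complex"
  assumes "(\<lambda>k. (cmod (a k))\<^sup>2) summable_on UNIV" "(\<lambda>k. (cmod (b k))\<^sup>2) summable_on UNIV"
  shows "(\<lambda>k. (cmod (a k + b k))\<^sup>2) summable_on UNIV"
proof (rule summable_on_comparison_test)
  show "(\<lambda>k. 2 * (cmod (a k))\<^sup>2 + 2 * (cmod (b k))\<^sup>2) summable_on UNIV"
    by (intro summable_on_add summable_on_cmult_right assms)
  fix k
  have "(cmod (a k + b k))\<^sup>2 \<le> (cmod (a k) + cmod (b k))\<^sup>2"
    by (intro power_mono norm_triangle_ineq) auto
  also have "\<dots> \<le> 2 * (cmod (a k))\<^sup>2 + 2 * (cmod (b k))\<^sup>2"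
    using sum_squares_bound[of "cmod (a k)" "cmod (b k)"] by (simp add: power2_sum)
  finally show "(cmod (a k + b k))\<^sup>2 \<le> 2 * (cmod (a k))\<^sup>2 + 2 * (cmod (b k))\<^sup>2" .
qed auto

lemma square_summable_cmult:
  fixes a :: "'k \<Rightarrow> complex"
  assumes "(\<lambda>k. (cmod (a k))\<^sup>2) summable_on UNIV"
  shows "(\<lambda>k. (cmod (c * a k))\<^sup>2) summable_on UNIV"
  using summable_on_cmult_right[OF assms, of "(cmod c)\<^sup>2"]
  by (simp add: norm_mult power_mult_distrib)

lemma square_summable_inner:
  fixes a b :: "'k \<Rightarrow> complex"
  assumes "(\<lambda>k. (cmod (a k))\<^sup>2) summable_on UNIV" "(\<lambda>k. (cmod (b k))\<^sup>2) summable_on UNIV"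
  shows "(\<lambda>k. a k * cnj (b k)) summable_on UNIV"
proof -
  have "(\<lambda>k. norm (a k * cnj (b k))) summable_on UNIV"
  proof (rule summable_on_comparison_test)
    show "(\<lambda>k. (cmod (a k))\<^sup>2 + (cmod (b k))\<^sup>2) summable_on UNIV"
      by (intro summable_on_add assms)
    fix k
    have "0 \<le> cmod (a k) * cmod (b k)" by simp
    with sum_squares_bound[of "cmod (a k)" "cmod (b k)"]
    have "cmod (a k) * cmod (b k) \<le> (cmod (a k))\<^sup>2 + (cmod (b k))\<^sup>2" by linarith
    thus "norm (a k * cnj (b k)) \<le> (cmod (a k))\<^sup>2 + (cmod (b k))\<^sup>2"
      by (simp add: norm_mult)
  qed auto
  thus ?thesis by (rule abs_summable_summable)
qed

lift_definition cscale :: "complex \<Rightarrow> hardy2 \<Rightarrow> hardy2" is "\<lambda>c f p. c * f p"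
  using bidisc_series_cmult square_summable_cmult by fastforce

instantiation hardy2 :: real_vector
begin

lift_definition zero_hardy2 :: hardy2 is "\<lambda>_. 0"
  by (auto intro!: exI[of _ "\<lambda>_. 0"] bidisc_series_const_0)

lift_definition plus_hardy2 :: "hardy2 \<Rightarrow> hardy2 \<Rightarrow> hardy2" is "\<lambda>f g p. f p + g p"
proof -
  fix f g :: "complex \<times> complex \<Rightarrow> complex"
  assume f: "(\<exists>a. (\<lambda>k. (cmod (a k))\<^sup>2) summable_on UNIV \<and> bidisc_series f a) \<and>
    (\<forall>p. p \<notin> unit_disc \<times> unit_disc \<longrightarrow> f p = 0)"
  assume g: "(\<exists>a. (\<lambda>k. (cmod (a k))\<^sup>2) summable_on UNIV \<and> bidisc_series g a) \<and>
    (\<forall>p. p \<notin> unit_disc \<times> unit_disc \<longrightarrow> g p = 0)"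
  from f obtain a where a: "(\<lambda>k. (cmod (a k))\<^sup>2) summable_on UNIV" "bidisc_series f a" by blast
  from g obtain b where b: "(\<lambda>k. (cmod (b k))\<^sup>2) summable_on UNIV" "bidisc_series g b" by blast
  show "(\<exists>a. (\<lambda>k. (cmod (a k))\<^sup>2) summable_on UNIV \<and> bidisc_series (\<lambda>p. f p + g p) a) \<and>
    (\<forall>p. p \<notin> unit_disc \<times> unit_disc \<longrightarrow> f p + g p = 0)"
  proof
    show "\<exists>a. (\<lambda>k. (cmod (a k))\<^sup>2) summable_on UNIV \<and> bidisc_series (\<lambda>p. f p + g p) a"
      by (intro exI conjI) (fact square_summable_add[OF a(1) b(1)] bidisc_series_add[OF a(2) b(2)])+
    show "\<forall>p. p \<notin> unit_disc \<times> unit_disc \<longrightarrow> f p + g p = 0"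
      using f g by simp
  qed
qed

definition uminus_hardy2 :: "hardy2 \<Rightarrow> hardy2"
  where "uminus_hardy2 f = cscale (-1) f"

definition minus_hardy2 :: "hardy2 \<Rightarrow> hardy2 \<Rightarrow> hardy2"
  where "minus_hardy2 f g = f + (- g)"

definition scaleR_hardy2 :: "real \<Rightarrow> hardy2 \<Rightarrow> hardy2"
  where "scaleR_hardy2 r f = cscale (complex_of_real r) f"

instance
proof
  fix f g h :: hardy2 and r s :: real
  show "f + g + h = f + (g + h)" "f + g = g + f" "0 + f = f"
    by (transfer, simp add: fun_eq_iff algebra_simps)+
  show "- f + f = 0"
    unfolding uminus_hardy2_def by transfer simp
  show "f - g = f + - g"
    by (fact minus_hardy2_def)
  show "r *\<^sub>R (f + g) = r *\<^sub>R f + r *\<^sub>R g" "(r + s) *\<^sub>R f = r *\<^sub>R f + s *\<^sub>R f"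
    "r *\<^sub>R s *\<^sub>R f = (r * s) *\<^sub>R f" "1 *\<^sub>R f = f"
    unfolding scaleR_hardy2_def by (transfer, simp add: fun_eq_iff algebra_simps)+
qed

end

definition hcoeff :: "hardy2 \<Rightarrow> nat \<times> nat \<Rightarrow> complex"
  where "hcoeff f = (THE a. bidisc_series (hfun f) a)"

lemma hcoeff_eqI: "bidisc_series (hfun f) a \<Longrightarrow> hcoeff f = a"
  unfolding hcoeff_def by (rule the_equality) (auto intro: bidisc_series_unique)

lemma
  shows bidisc_series_hcoeff: "bidisc_series (hfun f) (hcoeff f)"
    and square_summable_hcoeff: "(\<lambda>k. (cmod (hcoeff f k))\<^sup>2) summable_on UNIV"
proof -
  obtain a where a: "(\<lambda>k. (cmod (a k))\<^sup>2) summable_on UNIV" "bidisc_series (hfun f) a"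
    using hfun[of f] by blast
  have "hcoeff f = a" by (rule hcoeff_eqI) (fact a)
  with a show "bidisc_series (hfun f) (hcoeff f)"
    "(\<lambda>k. (cmod (hcoeff f k))\<^sup>2) summable_on UNIV"
    by simp_all
qed

lemma hcoeff_add: "hcoeff (f + g) k = hcoeff f k + hcoeff g k"
  using bidisc_series_add[OF bidisc_series_hcoeff[of f] bidisc_series_hcoeff[of g]]
  by (subst hcoeff_eqI[of "f + g"]) (auto simp: plus_hardy2.rep_eq)

lemma hcoeff_cscale: "hcoeff (cscale c f) k = c * hcoeff f k"
  using bidisc_series_cmult[OF bidisc_series_hcoeff[of f]]
  by (subst hcoeff_eqI[of "cscale c f"]) (auto simp: cscale.rep_eq)

lemma cscale_0: "cscale c 0 = 0"
  by transfer simp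

lemma hcoeff_eq_0_iff: "(\<forall>k. hcoeff f k = 0) \<longleftrightarrow> f = 0"
proof
  assume 0: "\<forall>k. hcoeff f k = 0"
  have "hfun f (z, w) = 0" for z w
  proof (cases "z \<in> unit_disc \<and> w \<in> unit_disc")
    case True
    hence "((\<lambda>(m, n). hcoeff f (m, n) * z ^ m * w ^ n) has_sum hfun f (z, w)) UNIV"
      using bidisc_series_hcoeff[of f] unfolding bidisc_series_def by blast
    hence "((\<lambda>_. 0) has_sum hfun f (z, w)) (UNIV :: (nat \<times> nat) set)"
      using 0 by (simp add: case_prod_unfold)
    moreover have "((\<lambda>_. 0) has_sum (0 :: complex)) (UNIV :: (nat \<times> nat) set)"
      by simp
    ultimately show ?thesis by (rule has_sum_unique)
  next
    case False
    thus ?thesis using hfun[of f] by auto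
  qed
  hence "hfun f = hfun 0" by (auto simp: zero_hardy2.rep_eq)
  thus "f = 0" by (simp add: hfun_inject)
next
  assume "f = 0"
  thus "\<forall>k. hcoeff f k = 0"
    using hcoeff_cscale[of 0 0] by (simp add: cscale_0)
qed

text \<open>The inner product of \<open>L\<^sup>2\<close> of the torus (normalised Lebesgue measure) in terms of Fourier
  coefficients; linear in the first argument.\<close>

definition cinner :: "hardy2 \<Rightarrow> hardy2 \<Rightarrow> complex"
  where "cinner f g = (\<Sum>\<^sub>\<infinity>k. hcoeff f k * cnj (hcoeff g k))"

lemma cinner_self: "cinner f f = complex_of_real (\<Sum>\<^sub>\<infinity>k. (cmod (hcoeff f k))\<^sup>2)"
  unfolding cinner_def complex_norm_square[symmetric]
  by (intro infsumI has_sum_of_real has_sum_infsum square_summable_hcoeff)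

lemma cinner_commute: "cinner g f = cnj (cinner f g)"
  unfolding cinner_def by (simp add: infsum_cnj[symmetric] mult.commute del: infsum_cnj)

lemma cinner_add_left: "cinner (f + g) h = cinner f h + cinner g h"
  unfolding cinner_def hcoeff_add distrib_right
  by (intro infsum_add square_summable_inner square_summable_hcoeff)

lemma cinner_cscale_left: "cinner (cscale c f) g = c * cinner f g"
  unfolding cinner_def hcoeff_cscale mult.assoc
  by (intro infsum_cmult_right square_summable_inner square_summable_hcoeff)

instantiation hardy2 :: real_inner
begin

definition inner_hardy2 :: "hardy2 \<Rightarrow> hardy2 \<Rightarrow> real"
  where "inner_hardy2 f g = Re (cinner f g)"

definition norm_hardy2 :: "hardy2 \<Rightarrow> real"
  where "norm_hardy2 f = sqrt (inner f f)"

definition dist_hardy2 :: "hardy2 \<Rightarrow> hardy2 \<Rightarrow> real"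
  where "dist_hardy2 f g = norm (f - g)"

definition sgn_hardy2 :: "hardy2 \<Rightarrow> hardy2"
  where "sgn_hardy2 f = f /\<^sub>R norm f"

definition uniformity_hardy2 :: "(hardy2 \<times> hardy2) filter"
  where "uniformity_hardy2 = (INF e\<in>{0<..}. principal {(f, g). dist f g < e})"

definition open_hardy2 :: "hardy2 set \<Rightarrow> bool"
  where "open_hardy2 U \<longleftrightarrow> (\<forall>f\<in>U. eventually (\<lambda>(f', g). f' = f \<longrightarrow> g \<in> U) uniformity)"

instance
proof
  fix f g h :: hardy2 and r :: real
  show "inner f g = inner g f"
    unfolding inner_hardy2_def using cinner_commute[of f g] by simp
  show "inner (f + g) h = inner f h + inner g h"
    by (simp add: inner_hardy2_def cinner_add_left)
  show "inner (r *\<^sub>R f) g = r * inner f g"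
    by (simp add: inner_hardy2_def scaleR_hardy2_def cinner_cscale_left)
  show "0 \<le> inner f f"
    by (simp add: inner_hardy2_def cinner_self infsum_nonneg)
  show "inner f f = 0 \<longleftrightarrow> f = 0"
  proof
    assume "inner f f = 0"
    hence "(\<Sum>\<^sub>\<infinity>k. (cmod (hcoeff f k))\<^sup>2) = 0" by (simp add: inner_hardy2_def cinner_self)
    hence "(cmod (hcoeff f k))\<^sup>2 = 0" for k
      by (intro nonneg_infsum_le_0D[OF _ square_summable_hcoeff]) auto
    hence "\<forall>k. hcoeff f k = 0" by simp
    thus "f = 0" by (simp only: hcoeff_eq_0_iff)
  next
    assume "f = 0"
    hence "hcoeff f k = 0" for k using hcoeff_eq_0_iff[of f] by blast
    thus "inner f f = 0" by (simp add: inner_hardy2_def cinner_self)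
  qed
qed (fact norm_hardy2_def dist_hardy2_def sgn_hardy2_def uniformity_hardy2_def open_hardy2_def)+

end

global_interpretation hardy2: vector_space cscale
  defines hardy2_span = hardy2.span and hardy2_dim = hardy2.dim
  by standard (transfer, simp add: fun_eq_iff algebra_simps)+

lift_definition mult_w :: "hardy2 \<Rightarrow> hardy2" is "\<lambda>f (z, w). w * f (z, w)"
proof -
  fix f :: "complex \<times> complex \<Rightarrow> complex"
  assume "(\<exists>a. (\<lambda>k. (cmod (a k))\<^sup>2) summable_on UNIV \<and> bidisc_series f a) \<and>
    (\<forall>p. p \<notin> unit_disc \<times> unit_disc \<longrightarrow> f p = 0)"
  then obtain a where a: "(\<lambda>k. (cmod (a k))\<^sup>2) summable_on UNIV" "bidisc_series f a"
    and f: "\<forall>p. p \<notin> unit_disc \<times> unit_disc \<longrightarrow> f p = 0" by blast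
  define b where "b = (\<lambda>(m::nat, n::nat). if n = 0 then 0 else a (m, n - 1))"
  define s where "s = (\<lambda>(m::nat, n::nat). (m, Suc n))"
  have inj: "inj s" by (auto simp: inj_on_def s_def)
  have ran: "k \<in> range s" if "snd k \<noteq> 0" for k
    using that by (intro image_eqI[of _ _ "(fst k, snd k - 1)"]) (auto simp: s_def prod_eq_iff)
  have b0: "b k = 0" if "k \<notin> range s" for k
    using ran[of k] that by (auto simp: b_def case_prod_unfold)
  have "(\<lambda>k. (cmod (b k))\<^sup>2) \<circ> s = (\<lambda>k. (cmod (a k))\<^sup>2)"
    by (auto simp: fun_eq_iff b_def s_def)
  with a(1) have "(\<lambda>k. (cmod (b k))\<^sup>2) summable_on range s"
    by (subst summable_on_reindex[OF inj]) simp
  hence 1: "(\<lambda>k. (cmod (b k))\<^sup>2) summable_on UNIV"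
    by (rule summable_on_cong_neutral[THEN iffD1, rotated -1]) (auto simp: b0)
  have "bidisc_series (\<lambda>(z, w). w * f (z, w)) b"
    unfolding bidisc_series_def
  proof (intro ballI)
    fix z w :: complex assume zw: "z \<in> unit_disc" "w \<in> unit_disc"
    have "((\<lambda>k. w * (case k of (m, n) \<Rightarrow> a (m, n) * z ^ m * w ^ n)) has_sum w * f (z, w)) UNIV"
      using a(2) zw unfolding bidisc_series_def by (intro has_sum_cmult_right) auto
    also have "(\<lambda>k. w * (case k of (m, n) \<Rightarrow> a (m, n) * z ^ m * w ^ n)) =
        (\<lambda>(m, n). b (m, n) * z ^ m * w ^ n) \<circ> s"
      by (auto simp: fun_eq_iff b_def s_def)
    finally have "((\<lambda>(m, n). b (m, n) * z ^ m * w ^ n) has_sum w * f (z, w)) (range s)"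
      by (subst has_sum_reindex[OF inj])
    hence "((\<lambda>(m, n). b (m, n) * z ^ m * w ^ n) has_sum w * f (z, w)) UNIV"
      by (rule has_sum_cong_neutral[THEN iffD1, rotated -1]) (auto simp: b0)
    thus "((\<lambda>(m, n). b (m, n) * z ^ m * w ^ n) has_sum (case (z, w) of (z, w) \<Rightarrow> w * f (z, w))) UNIV"
      by simp
  qed
  with 1 f show "(\<exists>a. (\<lambda>k. (cmod (a k))\<^sup>2) summable_on UNIV \<and>
      bidisc_series (\<lambda>(z, w). w * f (z, w)) a) \<and>
    (\<forall>p. p \<notin> unit_disc \<times> unit_disc \<longrightarrow> (case p of (z, w) \<Rightarrow> w * f (z, w)) = 0)"
    by auto
qed

section \<open>Operators on a closed subspace of the Hardy space\<close>

text \<open>An operator on a closed subspace \<open>N\<close> is a total function of which only the values on \<open>N\<close>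
  matter.\<close>

definition bounded_op_on :: "hardy2 set \<Rightarrow> (hardy2 \<Rightarrow> hardy2) \<Rightarrow> bool"
  where "bounded_op_on N A \<longleftrightarrow> A ` N \<subseteq> N \<and>
    (\<forall>f\<in>N. \<forall>g\<in>N. A (f + g) = A f + A g) \<and>
    (\<forall>c. \<forall>f\<in>N. A (cscale c f) = cscale c (A f)) \<and>
    (\<exists>K. \<forall>f\<in>N. norm (A f) \<le> K * norm f)"

definition spectrum_on :: "hardy2 set \<Rightarrow> (hardy2 \<Rightarrow> hardy2) \<Rightarrow> complex set"
  where "spectrum_on N A = {\<alpha>. \<not> (\<exists>T. bounded_op_on N T \<and>
    (\<forall>f\<in>N. T (A f - cscale \<alpha> f) = f \<and> A (T f) - cscale \<alpha> (T f) = f))}"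

definition adjoint_on :: "hardy2 set \<Rightarrow> (hardy2 \<Rightarrow> hardy2) \<Rightarrow> hardy2 \<Rightarrow> hardy2"
  where "adjoint_on N A g = (THE h. h \<in> N \<and> (\<forall>f\<in>N. cinner (A f) g = cinner f h))"

definition ker_on :: "hardy2 set \<Rightarrow> (hardy2 \<Rightarrow> hardy2) \<Rightarrow> hardy2 set"
  where "ker_on N A = {f \<in> N. A f = 0}"

definition finite_dim :: "hardy2 set \<Rightarrow> bool"
  where "finite_dim S \<longleftrightarrow> (\<exists>B. finite B \<and> S \<subseteq> hardy2_span B)"

definition fredholm_on :: "hardy2 set \<Rightarrow> (hardy2 \<Rightarrow> hardy2) \<Rightarrow> bool"
  where "fredholm_on N A \<longleftrightarrow> bounded_op_on N A \<and> closed (A ` N) \<and>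
    finite_dim (ker_on N A) \<and> finite_dim (ker_on N (adjoint_on N A))"

definition index_on :: "hardy2 set \<Rightarrow> (hardy2 \<Rightarrow> hardy2) \<Rightarrow> int"
  where "index_on N A =
    int (hardy2_dim (ker_on N A)) - int (hardy2_dim (ker_on N (adjoint_on N A)))"

definition orth_compl :: "hardy2 set \<Rightarrow> hardy2 set"
  where "orth_compl M = {f. \<forall>g\<in>M. cinner f g = 0}"

definition orth_proj :: "hardy2 set \<Rightarrow> hardy2 \<Rightarrow> hardy2"
  where "orth_proj N f = (THE g. g \<in> N \<and> f - g \<in> orth_compl N)"

section \<open>The quotient module of \<open>z - \<phi>(w)\<close>\<close>

text \<open>\<open>H\<^sup>\<infinity>\<close> of the torus consists of the bounded functions in \<open>H\<^sup>2\<close>.\<close>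

definition Hinf :: "hardy2 set"
  where "Hinf = {h. bounded (range (hfun h))}"

text \<open>The set inside the closure is \<open>(z - \<phi>(w)) H\<^sup>\<infinity>\<close>, its elements being named through their
  values on the bidisc.\<close>

definition M_phi :: "(complex \<Rightarrow> complex) \<Rightarrow> hardy2 set"
  where "M_phi \<phi> = closure {f. \<exists>h\<in>Hinf. \<forall>z\<in>unit_disc. \<forall>w\<in>unit_disc.
           hfun f (z, w) = (z - \<phi> w) * hfun h (z, w)}"

definition N_phi :: "(complex \<Rightarrow> complex) \<Rightarrow> hardy2 set"
  where "N_phi \<phi> = orth_compl (M_phi \<phi>)"

definition S_w :: "(complex \<Rightarrow> complex) \<Rightarrow> hardy2 \<Rightarrow> hardy2"
  where "S_w \<phi> f = orth_proj (N_phi \<phi>) (mult_w f)"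

definition Omega_phi :: "(complex \<Rightarrow> complex) \<Rightarrow> complex set"
  where "Omega_phi \<phi> = {w \<in> unit_disc. cmod (\<phi> w) < 1}"

end

theory Submission
  imports Defs
begin

text \<open>
  For \<open>\<alpha> \<in> \<Omega>\<^sub>\<phi>\<close> the operator \<open>S\<^sub>w - \<alpha>\<close> is bounded below on \<open>N\<^sub>\<phi>\<close>.  Indeed, let \<open>f \<in> N\<^sub>\<phi>\<close> and suppose that
  \<open>(w - \<alpha>) f\<close> is close to \<open>(z - \<phi>) h\<close> with \<open>h\<close> bounded.  Restricting to \<open>w = \<alpha>\<close> shows that
  \<open>(z - \<phi> \<alpha>) h(z, \<alpha>)\<close> is small, hence so is \<open>h(z, \<alpha>)\<close>, because \<open>\<bar>\<phi> \<alpha>\<bar> < 1\<close>.  So \<open>h\<close> may be replaced by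
  \<open>h - h(z, \<alpha>) = (w - \<alpha>) g\<close>, and cancelling \<open>w - \<alpha>\<close>, which is bounded below, puts \<open>f\<close> close to
  \<open>(z - \<phi>) g\<close>, which is orthogonal to \<open>f\<close>.  Thus the kernel is trivial and the range is closed.

  The adjoint is the restriction of the backward shift minus \<open>cnj \<alpha>\<close>.  The Taylor coefficients of
  an element of its kernel satisfy a geometric recursion in \<open>n\<close> by the eigenvalue equation, and one
  in \<open>m\<close> by orthogonality to \<open>(z - \<phi>) z\<^sup>m\<close>; so the kernel is spanned by the Szego kernel at
  \<open>(\<phi> \<alpha>, \<alpha>)\<close>.  The norm of a bounded inverse of \<open>S\<^sub>w - \<alpha>\<close> would bound the distance of \<open>\<alpha>\<close> from
  \<open>\<Omega>\<^sub>\<phi>\<close> below, by evaluation at such kernels, which gives the inclusion of the closure.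
\<close>

section \<open>The Hardy space as a Hilbert space\<close>

lemma hfun_add: "hfun (f + g) p = hfun f p + hfun g p"
  by (simp add: plus_hardy2.rep_eq)

lemma hfun_cscale: "hfun (cscale c f) p = c * hfun f p"
  by (simp add: cscale.rep_eq)

lemma hfun_zero: "hfun 0 p = 0"
  by (simp add: zero_hardy2.rep_eq)

lemma diff_conv_cscale: "f - g = f + cscale (- 1) g" for f g :: hardy2
  unfolding minus_hardy2_def uminus_hardy2_def by (rule refl)

lemma hfun_diff: "hfun (f - g) p = hfun f p - hfun g p"
  unfolding diff_conv_cscale hfun_add hfun_cscale by simp

lemma hfun_uminus: "hfun (- f) p = - hfun f p"
  unfolding uminus_hardy2_def hfun_cscale by simp

lemma hcoeff_diff: "hcoeff (f - g) k = hcoeff f k - hcoeff g k"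
  unfolding diff_conv_cscale hcoeff_add hcoeff_cscale by simp

lemma hcoeff_zero: "hcoeff 0 k = 0"
  using hcoeff_eq_0_iff by blast

lemma hfun_mult_w: "hfun (mult_w f) (z, w) = w * hfun f (z, w)"
  by (simp add: mult_w.rep_eq)

lemma hfun_outside: "p \<notin> unit_disc \<times> unit_disc \<Longrightarrow> hfun f p = 0"
  using hfun[of f] by blast

lemma hardy2_eqI:
  assumes "\<And>z w. z \<in> unit_disc \<Longrightarrow> w \<in> unit_disc \<Longrightarrow> hfun f (z, w) = hfun g (z, w)"
  shows "f = g"
proof -
  have "hfun f p = hfun g p" for p
  proof (cases "p \<in> unit_disc \<times> unit_disc")
    case True
    then show ?thesis using assms by (cases p) auto
  next
    case False
    then show ?thesis using hfun_outside by simp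
  qed
  then show ?thesis by (simp add: hfun_inject[symmetric] fun_eq_iff)
qed

lemma hardy2_coeff_eqI:
  assumes "\<And>m n. hcoeff f (m, n) = hcoeff g (m, n)"
  shows "f = g"
proof -
  have "\<forall>k. hcoeff (f - g) k = 0" using assms by (auto simp: hcoeff_diff)
  then have "f - g = 0" by (simp only: hcoeff_eq_0_iff)
  then show ?thesis by simp
qed

text \<open>By nonnegativity, summing first along rows and then over the row sums already gives
  unconditional summability over pairs, as in Tonelli's theorem.\<close>

lemma has_sum_product_nonneg:
  fixes f :: "'a \<Rightarrow> real" and g :: "'b \<Rightarrow> real"
  assumes "(f has_sum S) UNIV" "(g has_sum T) UNIV" "\<And>x. 0 \<le> f x" "\<And>y. 0 \<le> g y"
  shows "((\<lambda>(x, y). f x * g y) has_sum S * T) UNIV"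
proof -
  have rows: "((\<lambda>y. case (x, y) of (x, y) \<Rightarrow> f x * g y) has_sum f x * T) UNIV" for x
    using has_sum_cmult_right[OF assms(2)] by simp
  have outer: "((\<lambda>x. f x * T) has_sum S * T) UNIV"
    by (intro has_sum_cmult_left assms)
  have "(\<lambda>(x, y). f x * g y) summable_on (SIGMA x:UNIV. UNIV)"
    by (rule summable_on_SigmaI[OF rows]) (use outer assms in \<open>auto simp: summable_on_def\<close>)
  then have "((\<lambda>(x, y). f x * g y) has_sum S * T) (SIGMA x:UNIV. UNIV)"
    by (rule has_sum_SigmaI[OF rows outer])
  then show ?thesis by simp
qed

lemma square_summable_monomials:
  assumes "z \<in> unit_disc" "w \<in> unit_disc"
  shows "(\<lambda>k. (cmod (case k of (m, n) \<Rightarrow> z ^ m * w ^ n))\<^sup>2) summable_on (UNIV :: (nat \<times> nat) set)"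
proof -
  have geo: "(\<lambda>n. (cmod x ^ n)\<^sup>2) summable_on (UNIV :: nat set)" if "x \<in> unit_disc" for x :: complex
  proof -
    have "(cmod x)\<^sup>2 < 1" using that by (simp add: abs_square_less_1)
    then have "summable (\<lambda>n. ((cmod x)\<^sup>2) ^ n)" by (intro summable_geometric) simp
    then show ?thesis
      by (simp add: summable_on_UNIV_nonneg_real_iff power_mult[symmetric] mult.commute)
  qed
  have "((\<lambda>(m, n). (cmod z ^ m)\<^sup>2 * (cmod w ^ n)\<^sup>2) has_sum
      infsum (\<lambda>m. (cmod z ^ m)\<^sup>2) UNIV * infsum (\<lambda>n. (cmod w ^ n)\<^sup>2) UNIV) (UNIV :: (nat \<times> nat) set)"
    using assms by (intro has_sum_product_nonneg has_sum_infsum geo) auto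
  then show ?thesis
    by (auto simp: summable_on_def case_prod_unfold norm_mult norm_power power_mult_distrib)
qed

text \<open>At a point of the bidisc the monomials are square summable, so by Cauchy-Schwarz every
  square summable family has a convergent series there. This identifies the space with all of the
  sequence space, and so lets operators be defined through coefficients.\<close>

lemma hcoeff_surj:
  assumes "(\<lambda>k. (cmod (a k))\<^sup>2) summable_on UNIV"
  shows "\<exists>f. hcoeff f = a"
proof -
  define F where "F = (\<lambda>(z, w). if z \<in> unit_disc \<and> w \<in> unit_disc
    then \<Sum>\<^sub>\<infinity>(m, n). a (m, n) * z ^ m * w ^ n else 0)"
  have "bidisc_series F a"
    unfolding bidisc_series_def
  proof (intro ballI)
    fix z w :: complex assume zw: "z \<in> unit_disc" "w \<in> unit_disc"
    have "(\<lambda>k. a k * cnj (case k of (m, n) \<Rightarrow> cnj z ^ m * cnj w ^ n)) summable_on UNIV"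
      using zw by (intro square_summable_inner assms square_summable_monomials) auto
    then have "(\<lambda>(m, n). a (m, n) * z ^ m * w ^ n) summable_on UNIV"
      by (simp add: case_prod_unfold mult_ac)
    then show "((\<lambda>(m, n). a (m, n) * z ^ m * w ^ n) has_sum F (z, w)) UNIV"
      using zw by (simp add: F_def)
  qed
  moreover have "\<forall>p. p \<notin> unit_disc \<times> unit_disc \<longrightarrow> F p = 0"
    by (auto simp: F_def)
  ultimately have "bidisc_series (hfun (Abs_hardy2 F)) a"
    using assms by (subst Abs_hardy2_inverse) auto
  then show ?thesis using hcoeff_eqI by blast
qed

text \<open>The choice is harmless, since coefficients determine the function. For a family that is
  not square summable the value is unspecified, so each use goes through
  \<open>hcoeff_Hser\<close>.\<close>

definition Hser :: "(nat \<times> nat \<Rightarrow> complex) \<Rightarrow> hardy2"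
  where "Hser a = (SOME f. hcoeff f = a)"

lemma hcoeff_Hser:
  assumes "(\<lambda>k. (cmod (a k))\<^sup>2) summable_on UNIV"
  shows "hcoeff (Hser a) = a"
  unfolding Hser_def using hcoeff_surj[OF assms] by (rule someI_ex)

section \<open>Norm and complex inner product through coefficients\<close>

lemma norm_hardy2_square: "(norm f)\<^sup>2 = (\<Sum>\<^sub>\<infinity>k. (cmod (hcoeff f k))\<^sup>2)"
  by (simp add: power2_norm_eq_inner inner_hardy2_def cinner_self)

lemma norm_square_eq_cinner: "complex_of_real ((norm f)\<^sup>2) = cinner f f"
  by (simp only: norm_hardy2_square cinner_self)

lemma norm_cscale: "norm (cscale c f) = cmod c * norm f"
proof -
  have "(norm (cscale c f))\<^sup>2 = (\<Sum>\<^sub>\<infinity>k. (cmod c)\<^sup>2 * (cmod (hcoeff f k))\<^sup>2)"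
    by (simp add: norm_hardy2_square hcoeff_cscale norm_mult power_mult_distrib)
  also have "\<dots> = (cmod c)\<^sup>2 * (norm f)\<^sup>2"
    unfolding norm_hardy2_square by (intro infsum_cmult_right square_summable_hcoeff)
  also have "\<dots> = (cmod c * norm f)\<^sup>2" by (simp add: power_mult_distrib)
  finally show ?thesis
    by (metis norm_ge_zero power2_eq_imp_eq mult_nonneg_nonneg)
qed

lemma norm_le_coeffI:
  assumes "\<And>k. cmod (hcoeff f k) \<le> cmod (hcoeff g k)"
  shows "norm f \<le> norm g"
proof -
  have "(norm f)\<^sup>2 \<le> (norm g)\<^sup>2"
    unfolding norm_hardy2_square
    by (intro infsum_mono square_summable_hcoeff power_mono assms) auto
  then show ?thesis by (rule power2_le_imp_le) simp
qed

lemma cinner_cscale_right: "cinner f (cscale c g) = cnj c * cinner f g"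
  by (metis cinner_commute cinner_cscale_left complex_cnj_mult)

lemma cinner_diff_left: "cinner (f - g) h = cinner f h - cinner g h"
  unfolding diff_conv_cscale cinner_add_left cinner_cscale_left by simp

lemma cinner_diff_right: "cinner h (f - g) = cinner h f - cinner h g"
  by (metis cinner_commute cinner_diff_left complex_cnj_diff)

lemma cinner_zero: "cinner 0 g = 0" "cinner g 0 = 0"
  by (simp_all add: cinner_def hcoeff_zero)

lemma cinner_self_eq_0: "cinner f f = 0 \<longleftrightarrow> f = 0"
  unfolding norm_square_eq_cinner[symmetric] by simp

text \<open>Complex multiples are rotated so that the real inequality applies.\<close>

lemma norm_cinner_le: "cmod (cinner f g) \<le> norm f * norm g"
proof (cases "cinner f g = 0")
  case False
  define c where "c = cnj (cinner f g) / cmod (cinner f g)"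
  have c: "cmod c = 1" using False by (simp add: c_def norm_divide)
  have "cinner (cscale c f) g = cmod (cinner f g)"
  proof -
    have "cinner (cscale c f) g * cmod (cinner f g) = cinner f g * cnj (cinner f g)"
      using False by (simp add: cinner_cscale_left c_def)
    also have "\<dots> = complex_of_real (cmod (cinner f g)) * cmod (cinner f g)"
      by (simp only: complex_norm_square[symmetric] power2_eq_square of_real_mult)
    finally show ?thesis using False by simp
  qed
  then have "cmod (cinner f g) = inner (cscale c f) g"
    by (simp add: inner_hardy2_def)
  also have "\<dots> \<le> norm (cscale c f) * norm g" by (rule norm_cauchy_schwarz)
  finally show ?thesis by (simp add: norm_cscale c)
qed auto

lemma tendsto_cinner_left:
  assumes "(f \<longlongrightarrow> l) F"
  shows "((\<lambda>x. cinner (f x) g) \<longlongrightarrow> cinner l g) F"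
proof (rule LIM_zero_cancel, rule Lim_null_comparison)
  show "\<forall>\<^sub>F x in F. norm (cinner (f x) g - cinner l g) \<le> norm (f x - l) * norm g"
    using norm_cinner_le by (simp add: cinner_diff_left[symmetric])
  show "((\<lambda>x. norm (f x - l) * norm g) \<longlongrightarrow> 0) F"
    using assms by (intro tendsto_mult_left_zero tendsto_norm_zero LIM_zero)
qed

text \<open>Completeness of the sequence space carried over to functions. It is what the nearest
  point argument, the fixed point argument for the resolvent and the closed range argument rest
  on.\<close>

instance hardy2 :: complete_space
proof
  fix X :: "nat \<Rightarrow> hardy2"
  assume X: "Cauchy X"
  have coeff_le: "cmod (hcoeff f k) \<le> norm f" for f k
  proof -
    have "(\<Sum>j\<in>{k}. (cmod (hcoeff f j))\<^sup>2) \<le> (norm f)\<^sup>2"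
      unfolding norm_hardy2_square by (intro finite_sum_le_infsum square_summable_hcoeff) auto
    then have "(cmod (hcoeff f k))\<^sup>2 \<le> (norm f)\<^sup>2" by simp
    then show ?thesis by (rule power2_le_imp_le) simp
  qed
  have "Cauchy (\<lambda>n. hcoeff (X n) k)" for k
  proof (rule CauchyI)
    fix e :: real assume "e > 0"
    with X obtain M where "\<forall>m\<ge>M. \<forall>n\<ge>M. norm (X m - X n) < e" using CauchyD by blast
    then show "\<exists>M. \<forall>m\<ge>M. \<forall>n\<ge>M. norm (hcoeff (X m) k - hcoeff (X n) k) < e"
      using coeff_le[of _ k] by (metis hcoeff_diff le_less_trans)
  qed
  then have "\<exists>l. (\<lambda>n. hcoeff (X n) k) \<longlonglongrightarrow> l" for k
    by (simp add: Cauchy_convergent_iff convergent_def)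
  then obtain a where a: "\<And>k. (\<lambda>n. hcoeff (X n) k) \<longlonglongrightarrow> a k" by metis
  \<comment> \<open>Only coefficientwise limits are known so far. Over a finite index set they can
    be taken inside the sum, and a bound uniform in the set then controls the infinite sum.\<close>
  have fin: "(\<Sum>k\<in>I. (cmod (hcoeff (X n) k - a k))\<^sup>2) \<le> e\<^sup>2"
    if "finite I" "\<And>m. m \<ge> M \<Longrightarrow> norm (X n - X m) \<le> e" for I M n e
  proof (rule tendsto_upperbound)
    show "(\<lambda>m. \<Sum>k\<in>I. (cmod (hcoeff (X n) k - hcoeff (X m) k))\<^sup>2)
        \<longlonglongrightarrow> (\<Sum>k\<in>I. (cmod (hcoeff (X n) k - a k))\<^sup>2)"
      by (intro tendsto_intros a)
    have "(\<Sum>k\<in>I. (cmod (hcoeff (X n) k - hcoeff (X m) k))\<^sup>2) \<le> e\<^sup>2" if "m \<ge> M" for m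
    proof -
      have "(\<Sum>k\<in>I. (cmod (hcoeff (X n) k - hcoeff (X m) k))\<^sup>2) \<le> (norm (X n - X m))\<^sup>2"
        unfolding norm_hardy2_square hcoeff_diff[symmetric]
        using \<open>finite I\<close> by (intro finite_sum_le_infsum square_summable_hcoeff) auto
      also have "\<dots> \<le> e\<^sup>2"
        using \<open>m \<ge> M\<close> \<open>\<And>m. m \<ge> M \<Longrightarrow> norm (X n - X m) \<le> e\<close> by (intro power_mono) auto
      finally show ?thesis .
    qed
    then show "\<forall>\<^sub>F m in sequentially. (\<Sum>k\<in>I. (cmod (hcoeff (X n) k - hcoeff (X m) k))\<^sup>2) \<le> e\<^sup>2"
      by (auto simp: eventually_sequentially)
  qed simp
  have summ: "(\<lambda>k. (cmod (hcoeff (X n) k - a k))\<^sup>2) summable_on UNIV"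
    and bound: "(\<Sum>\<^sub>\<infinity>k. (cmod (hcoeff (X n) k - a k))\<^sup>2) \<le> e\<^sup>2"
    if "\<And>m. m \<ge> M \<Longrightarrow> norm (X n - X m) \<le> e" for n e M
  proof -
    show *: "(\<lambda>k. (cmod (hcoeff (X n) k - a k))\<^sup>2) summable_on UNIV"
      using fin[OF _ that] by (intro nonneg_bdd_above_summable_on bdd_aboveI2[of _ _ "e\<^sup>2"]) auto
    show "(\<Sum>\<^sub>\<infinity>k. (cmod (hcoeff (X n) k - a k))\<^sup>2) \<le> e\<^sup>2"
      using fin[OF _ that] by (intro infsum_le_finite_sums *) auto
  qed
  obtain M where "\<forall>m\<ge>M. \<forall>n\<ge>M. norm (X m - X n) < 1"
    using CauchyD[OF X, of 1] by auto
  then have M: "norm (X M - X m) \<le> 1" if "m \<ge> M" for m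
    using that by (simp add: less_imp_le)
  \<comment> \<open>The limit family \<open>a\<close> is written as \<open>X M\<close> minus the
    error \<open>X M - a\<close>, both of which are square summable.\<close>
  have "(\<lambda>k. (cmod (hcoeff (X M) k + (-1) * (hcoeff (X M) k - a k)))\<^sup>2) summable_on UNIV"
    by (intro square_summable_add square_summable_cmult square_summable_hcoeff summ[OF M])
  then have asum: "(\<lambda>k. (cmod (a k))\<^sup>2) summable_on UNIV" by simp
  have "X \<longlonglongrightarrow> Hser a"
  proof (rule LIMSEQ_I)
    fix r :: real assume "r > 0"
    then obtain N where N: "\<forall>m\<ge>N. \<forall>n\<ge>N. norm (X m - X n) < r / 2"
      using CauchyD[OF X, of "r / 2"] by auto
    have "norm (X n - Hser a) < r" if "n \<ge> N" for n
    proof -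
      have "(norm (X n - Hser a))\<^sup>2 \<le> (r / 2)\<^sup>2"
        unfolding norm_hardy2_square hcoeff_diff hcoeff_Hser[OF asum]
        using N that by (intro bound[of N]) (simp add: less_imp_le)
      then have "norm (X n - Hser a) \<le> r / 2"
        by (rule power2_le_imp_le) (use \<open>r > 0\<close> in simp)
      with \<open>r > 0\<close> show ?thesis by simp
    qed
    then show "\<exists>no. \<forall>n\<ge>no. norm (X n - Hser a) < r" by blast
  qed
  then show "convergent X" by (auto simp: convergent_def)
qed

section \<open>Orthogonal projections\<close>

text \<open>A minimising sequence is Cauchy by the parallelogram law: the midpoint of two of its
  terms lies in \<open>S\<close> and so is at squared distance at least \<open>d\<close> from
  \<open>f\<close>.\<close>

lemma closest_point_exists:
  fixes f :: "'a :: {real_inner, complete_space}"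
  assumes S: "subspace S" "closed S"
  shows "\<exists>g\<in>S. \<forall>h\<in>S. norm (f - g) \<le> norm (f - h)"
proof -
  define d where "d = (INF h\<in>S. (norm (f - h))\<^sup>2)"
  have ne: "S \<noteq> {}" using S subspace_0 by blast
  have bdd: "bdd_below ((\<lambda>h. (norm (f - h))\<^sup>2) ` S)" by (intro bdd_belowI2[of _ 0]) simp
  have d_le: "d \<le> (norm (f - h))\<^sup>2" if "h \<in> S" for h
    unfolding d_def by (rule cINF_lower[OF bdd that])
  have "\<exists>h\<in>S. (norm (f - h))\<^sup>2 < d + 1 / real (Suc n)" for n
    using cInf_lessD[of "(\<lambda>h. (norm (f - h))\<^sup>2) ` S" "d + 1 / real (Suc n)"] ne
    by (auto simp: d_def)
  then obtain g where gS: "\<And>n. g n \<in> S" and g: "\<And>n. (norm (f - g n))\<^sup>2 < d + 1 / real (Suc n)"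
    by metis
  have para: "(norm (g m - g n))\<^sup>2 \<le> 2 / real (Suc m) + 2 / real (Suc n)" for m n
  proof -
    define h where "h = (1 / 2) *\<^sub>R (g m + g n)"
    have "h \<in> S" unfolding h_def by (intro subspace_scale subspace_add S gS)
    have "(norm (g m - g n))\<^sup>2 + 4 * (norm (f - h))\<^sup>2 = 2 * (norm (f - g m))\<^sup>2 + 2 * (norm (f - g n))\<^sup>2"
      unfolding power2_norm_eq_inner h_def
      by (simp add: inner_simps inner_commute[of "g n" "g m"] inner_commute[of "g n" f] inner_commute[of "g m" f]
        field_simps)
    with g[of m] g[of n] d_le[OF \<open>h \<in> S\<close>] show ?thesis by simp
  qed
  have "Cauchy g"
  proof (rule CauchyI)
    fix e :: real assume "e > 0"
    then obtain N where N: "4 / e\<^sup>2 < real (Suc N)"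
      using reals_Archimedean2 less_trans by (metis lessI of_nat_less_iff)
    have "norm (g m - g n) < e" if "m \<ge> N" "n \<ge> N" for m n
    proof -
      have le: "2 / real (Suc k) \<le> 2 / real (Suc N)" if "k \<ge> N" for k
        using that by (intro divide_left_mono) auto
      have "(norm (g m - g n))\<^sup>2 \<le> 2 / real (Suc N) + 2 / real (Suc N)"
        using para[of m n] le[OF that(1)] le[OF that(2)] by linarith
      also have "\<dots> = 4 / real (Suc N)" by (simp add: add_divide_distrib[symmetric])
      also have "\<dots> < e\<^sup>2" using N \<open>e > 0\<close> by (simp add: field_simps)
      finally show ?thesis using \<open>e > 0\<close> power_less_imp_less_base by (metis less_imp_le)
    qed
    then show "\<exists>M. \<forall>m\<ge>M. \<forall>n\<ge>M. norm (g m - g n) < e" by blast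
  qed
  then obtain l where l: "g \<longlonglongrightarrow> l" using Cauchy_convergent convergent_def by blast
  have "l \<in> S" using S(2) gS l by (rule closed_sequentially)
  moreover have "(norm (f - l))\<^sup>2 \<le> d"
  proof (rule LIMSEQ_le)
    show "(\<lambda>n. (norm (f - g n))\<^sup>2) \<longlonglongrightarrow> (norm (f - l))\<^sup>2" by (intro tendsto_intros l)
    show "(\<lambda>n. d + 1 / real (Suc n)) \<longlonglongrightarrow> d"
      using tendsto_add[OF tendsto_const LIMSEQ_inverse_real_of_nat, of d] by (simp add: inverse_eq_divide)
    show "\<exists>N. \<forall>n\<ge>N. (norm (f - g n))\<^sup>2 \<le> d + 1 / real (Suc n)" using g by (auto intro: less_imp_le)
  qed
  then have "norm (f - l) \<le> norm (f - h)" if "h \<in> S" for h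
    using d_le[OF that] by (rule power2_le_imp_le[OF order_trans]) auto
  ultimately show ?thesis by blast
qed

lemma orthogonal_projection_exists:
  fixes f :: "'a :: {real_inner, complete_space}"
  assumes S: "subspace S" "closed S"
  shows "\<exists>g\<in>S. \<forall>h\<in>S. inner (f - g) h = 0"
proof -
  obtain g where g: "g \<in> S" and le: "\<And>h. h \<in> S \<Longrightarrow> norm (f - g) \<le> norm (f - h)"
    using closest_point_exists[OF S] by blast
  have "inner (f - g) h = 0" if h: "h \<in> S" for h
  proof (cases "h = 0")
    case False
    \<comment> \<open>This \<open>t\<close> minimises the quadratic
      \<open>norm (f - g - t *\<^sub>R h)\<close> squared along the line through \<open>g\<close> in
      direction \<open>h\<close>; minimality of \<open>g\<close> then forces the linear coefficient
      to vanish.\<close>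
    define t where "t = inner (f - g) h / inner h h"
    have "norm (f - g) \<le> norm (f - (g + t *\<^sub>R h))"
      by (intro le subspace_add subspace_scale S g h)
    then have "inner (f - g) (f - g) \<le> inner (f - g - t *\<^sub>R h) (f - g - t *\<^sub>R h)"
      by (simp add: norm_le diff_diff_eq)
    also have "\<dots> = inner (f - g) (f - g) - 2 * t * inner (f - g) h + t * (t * inner h h)"
      unfolding inner_diff_left[of "f - g"] inner_diff_right[of _ "f - g"] inner_scaleR_left inner_scaleR_right
        inner_commute[of h "f - g"]
      by (simp add: algebra_simps)
    also have "t * inner h h = inner (f - g) h"
      using False by (simp add: t_def)
    finally have "t * inner (f - g) h \<le> 0" by simp
    then have "(inner (f - g) h)\<^sup>2 / inner h h \<le> 0"
      by (simp add: t_def power2_eq_square)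
    moreover have "0 < inner h h" using False by simp
    ultimately have "(inner (f - g) h)\<^sup>2 \<le> 0" by (simp add: field_simps)
    then show ?thesis by simp
  qed simp
  with g show ?thesis by blast
qed

section \<open>Complex subspaces, orthogonal complements and projections\<close>

definition csubspace :: "hardy2 set \<Rightarrow> bool"
  where "csubspace S \<longleftrightarrow> 0 \<in> S \<and> (\<forall>f\<in>S. \<forall>g\<in>S. f + g \<in> S) \<and> (\<forall>c. \<forall>f\<in>S. cscale c f \<in> S)"

lemma csubspaceD:
  assumes "csubspace S"
  shows "0 \<in> S" "f \<in> S \<Longrightarrow> g \<in> S \<Longrightarrow> f + g \<in> S" "f \<in> S \<Longrightarrow> cscale c f \<in> S"
    "f \<in> S \<Longrightarrow> g \<in> S \<Longrightarrow> f - g \<in> S"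
  using assms unfolding csubspace_def diff_conv_cscale by blast+

lemma csubspace_imp_subspace: "csubspace S \<Longrightarrow> subspace S"
  unfolding csubspace_def subspace_def scaleR_hardy2_def by blast

lemma csubspace_orth_compl: "csubspace (orth_compl S)"
  unfolding csubspace_def orth_compl_def
  by (simp add: cinner_zero cinner_add_left cinner_cscale_left)

lemma closed_orth_compl: "closed (orth_compl S)"
  unfolding closed_sequential_limits
proof (intro allI impI, elim conjE)
  fix x l assume x: "\<forall>n. x n \<in> orth_compl S" "x \<longlonglongrightarrow> l"
  have "cinner l g = 0" if "g \<in> S" for g
  proof (rule LIMSEQ_unique)
    show "(\<lambda>n. cinner (x n) g) \<longlonglongrightarrow> cinner l g" by (intro tendsto_cinner_left x)
    show "(\<lambda>n. cinner (x n) g) \<longlonglongrightarrow> 0" using x(1) that by (simp add: orth_compl_def)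
  qed
  then show "l \<in> orth_compl S" by (simp add: orth_compl_def)
qed

lemma orth_complD: "f \<in> orth_compl S \<Longrightarrow> g \<in> S \<Longrightarrow> cinner f g = 0"
  by (simp add: orth_compl_def)

lemma orth_complD': "f \<in> orth_compl S \<Longrightarrow> g \<in> S \<Longrightarrow> cinner g f = 0"
  by (metis cinner_commute complex_cnj_zero orth_complD)

lemma orth_compl_Int: "f \<in> S \<Longrightarrow> f \<in> orth_compl S \<Longrightarrow> f = 0"
  using orth_complD cinner_self_eq_0 by blast

text \<open>The real projection theorem gives only the real part of orthogonality. Testing with \<i>
  times \<open>h\<close>, which is again in \<open>S\<close>, gives the imaginary part.\<close>

lemma orth_decomp:
  assumes "csubspace S" "closed S"
  shows "\<exists>g\<in>S. f - g \<in> orth_compl S"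
proof -
  obtain g where g: "g \<in> S" and orth: "\<And>h. h \<in> S \<Longrightarrow> inner (f - g) h = 0"
    using orthogonal_projection_exists[OF csubspace_imp_subspace[OF assms(1)] assms(2)] by blast
  have "cinner (f - g) h = 0" if "h \<in> S" for h
  proof (rule complex_eqI)
    show "Re (cinner (f - g) h) = Re 0" using orth[OF that] by (simp add: inner_hardy2_def)
    have "inner (f - g) (cscale \<i> h) = 0" using assms that by (intro orth csubspaceD)
    then show "Im (cinner (f - g) h) = Im 0" by (simp add: inner_hardy2_def cinner_cscale_right)
  qed
  with g show ?thesis by (auto simp: orth_compl_def)
qed

lemma orth_projI:
  assumes "csubspace S" "g \<in> S" "f - g \<in> orth_compl S"
  shows "orth_proj S f = g"
  unfolding orth_proj_def
proof (rule the_equality)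
  fix g' assume g': "g' \<in> S \<and> f - g' \<in> orth_compl S"
  have "f - g - (f - g') \<in> orth_compl S"
    using assms g' csubspaceD(4)[OF csubspace_orth_compl] by blast
  then have "g' - g \<in> orth_compl S" by simp
  moreover have "g' - g \<in> S" using assms g' csubspaceD(4) by blast
  ultimately have "g' - g = 0" by (intro orth_compl_Int)
  then show "g' = g" by simp
qed (use assms in simp)

lemma
  assumes "csubspace S" "closed S"
  shows orth_proj_in: "orth_proj S f \<in> S"
    and orth_proj_diff: "f - orth_proj S f \<in> orth_compl S"
  using orth_decomp[OF assms, of f] orth_projI[OF assms(1)] by metis+

lemma orth_proj_add:
  assumes "csubspace S" "closed S"
  shows "orth_proj S (f + g) = orth_proj S f + orth_proj S g"
proof (rule orth_projI)
  have "(f - orth_proj S f) + (g - orth_proj S g) \<in> orth_compl S"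
    by (intro csubspaceD csubspace_orth_compl orth_proj_diff assms)
  then show "f + g - (orth_proj S f + orth_proj S g) \<in> orth_compl S" by (simp add: algebra_simps)
qed (intro csubspaceD orth_proj_in assms)+

lemma cscale_diff: "cscale c (f - g) = cscale c f - cscale c g"
  by (rule hardy2.scale_right_diff_distrib)

lemma orth_proj_cscale:
  assumes "csubspace S" "closed S"
  shows "orth_proj S (cscale c f) = cscale c (orth_proj S f)"
proof (rule orth_projI)
  have "cscale c (f - orth_proj S f) \<in> orth_compl S"
    by (intro csubspaceD csubspace_orth_compl orth_proj_diff assms)
  then show "cscale c f - cscale c (orth_proj S f) \<in> orth_compl S" by (simp add: cscale_diff)
qed (intro csubspaceD orth_proj_in assms)+

lemma norm_le_norm_add_orth:
  assumes "cinner f g = 0"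
  shows "norm f \<le> norm (f + g)"
proof -
  have "inner f g = 0" using assms by (simp add: inner_hardy2_def)
  then have "(norm f)\<^sup>2 \<le> (norm (f + g))\<^sup>2"
    by (simp add: power2_norm_eq_inner inner_simps inner_commute[of g f])
  then show ?thesis by (rule power2_le_imp_le) simp
qed

lemma norm_orth_proj_le:
  assumes "csubspace S" "closed S"
  shows "norm (orth_proj S f) \<le> norm f"
  using norm_le_norm_add_orth[of "orth_proj S f" "f - orth_proj S f"]
    orth_complD'[OF orth_proj_diff[OF assms] orth_proj_in[OF assms]] by simp

text \<open>For \<open>f\<close> in the double complement, \<open>f - orth_proj S f\<close> lies
  both in the complement and in the double complement, hence vanishes.\<close>

lemma orth_compl_orth_compl:
  assumes "csubspace S" "closed S"
  shows "orth_compl (orth_compl S) = S"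
proof
  show "S \<subseteq> orth_compl (orth_compl S)"
    unfolding orth_compl_def[of "orth_compl S"] using orth_complD' by blast
  show "orth_compl (orth_compl S) \<subseteq> S"
  proof
    fix f assume f: "f \<in> orth_compl (orth_compl S)"
    have "orth_proj S f \<in> orth_compl (orth_compl S)"
      using orth_proj_in[OF assms] \<open>S \<subseteq> orth_compl (orth_compl S)\<close> by blast
    then have "f - orth_proj S f \<in> orth_compl (orth_compl S)"
      using f csubspaceD(4)[OF csubspace_orth_compl] by blast
    then have "f - orth_proj S f = 0"
      using orth_proj_diff[OF assms] orth_compl_Int by blast
    then show "f \<in> S" using orth_proj_in[OF assms, of f] by simp
  qed
qed

lemma csubspace_closure:
  assumes "csubspace S"
  shows "csubspace (closure S)"
proof -
  have "f + g \<in> closure S" if fg: "f \<in> closure S" "g \<in> closure S" for f g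
  proof -
    obtain x where "\<forall>n. x n \<in> S" "x \<longlonglongrightarrow> f"
      using fg(1) unfolding closure_sequential by blast
    moreover obtain y where "\<forall>n. y n \<in> S" "y \<longlonglongrightarrow> g"
      using fg(2) unfolding closure_sequential by blast
    ultimately have "\<forall>n. x n + y n \<in> S" "(\<lambda>n. x n + y n) \<longlonglongrightarrow> f + g"
      using csubspaceD(2)[OF assms] by (auto intro: tendsto_add)
    then show ?thesis by (auto simp: closure_sequential)
  qed
  moreover have "cscale c f \<in> closure S" if f: "f \<in> closure S" for c f
  proof -
    obtain x where x: "\<forall>n. x n \<in> S" "x \<longlonglongrightarrow> f"
      using f unfolding closure_sequential by blast
    have "(\<lambda>n. cscale c (x n)) \<longlonglongrightarrow> cscale c f"
    proof (rule LIM_zero_cancel, rule Lim_null_comparison)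
      show "\<forall>\<^sub>F n in sequentially. norm (cscale c (x n) - cscale c f) \<le> cmod c * norm (x n - f)"
        by (simp add: cscale_diff[symmetric] norm_cscale)
      show "(\<lambda>n. cmod c * norm (x n - f)) \<longlonglongrightarrow> 0"
        using x(2) by (intro tendsto_mult_right_zero tendsto_norm_zero LIM_zero)
    qed
    moreover have "\<forall>n. cscale c (x n) \<in> S" using x(1) csubspaceD(3)[OF assms] by blast
    ultimately show ?thesis by (auto simp: closure_sequential)
  qed
  moreover have "0 \<in> closure S" using csubspaceD(1)[OF assms] closure_subset by blast
  ultimately show ?thesis by (simp add: csubspace_def)
qed

section \<open>Shifts and slices\<close>

text \<open>The terms of \<open>b\<close> off the range of \<open>s\<close> contribute nothing, and
  on the range \<open>s\<close> is a reindexing.\<close>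

lemma has_sum_shift:
  assumes "inj s" "\<And>k. b (s k) = a k" "\<And>k. k \<notin> range s \<Longrightarrow> b k = 0"
  shows "(b has_sum S) UNIV \<longleftrightarrow> (a has_sum S) UNIV"
proof -
  have "(b has_sum S) UNIV \<longleftrightarrow> (b has_sum S) (range s)"
    using assms(3) by (intro has_sum_cong_neutral) auto
  also have "\<dots> \<longleftrightarrow> (b \<circ> s has_sum S) UNIV"
    by (rule has_sum_reindex[OF assms(1)])
  also have "b \<circ> s = a" using assms(2) by auto
  finally show ?thesis .
qed

lemma infsum_shift:
  fixes a b :: "'k \<Rightarrow> 'b :: {comm_monoid_add, t2_space}"
  assumes "inj s" "\<And>k. b (s k) = a k" "\<And>k. k \<notin> range s \<Longrightarrow> b k = 0"
  shows "infsum b UNIV = infsum a UNIV"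
proof (cases "a summable_on UNIV")
  case True
  then have "(b has_sum infsum a UNIV) UNIV"
    using has_sum_shift[where s = s and a = a and b = b, OF assms] by simp
  then show ?thesis by (rule infsumI)
next
  case False
  \<comment> \<open>Without summability both sides are the default value 0 of
    \<open>infsum\<close>.\<close>
  then have "\<not> b summable_on UNIV"
    unfolding summable_on_def by (simp add: has_sum_shift[where s = s and a = a and b = b, OF assms])
  with False show ?thesis by (simp add: infsum_not_exists)
qed

lemma summable_on_shift:
  assumes "inj s" "\<And>k. b (s k) = a k" "\<And>k. k \<notin> range s \<Longrightarrow> b k = 0"
  shows "b summable_on UNIV \<longleftrightarrow> a summable_on UNIV"
  unfolding summable_on_def by (simp add: has_sum_shift[where s = s and a = a and b = b, OF assms])

text \<open>Hypothesis \<open>mono\<close> says that moving exponents by \<open>s\<close> multiplies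
  every monomial by one common factor. The factor is \<open>z\<close> for \<open>shift_z\<close> and
  \<open>w\<close> for \<open>shift_w\<close>.\<close>

lemma bidisc_series_shift:
  fixes s :: "nat \<times> nat \<Rightarrow> nat \<times> nat"
  assumes "bidisc_series f a" "inj s" "\<And>k. b (s k) = a k" "\<And>k. k \<notin> range s \<Longrightarrow> b k = 0"
    and mono: "\<And>m n z w. z ^ fst (s (m, n)) * w ^ snd (s (m, n)) = c z w * (z ^ m * w ^ n)"
  shows "bidisc_series (\<lambda>(z, w). c z w * f (z, w)) b"
  unfolding bidisc_series_def
proof (intro ballI)
  fix z w :: complex assume zw: "z \<in> unit_disc" "w \<in> unit_disc"
  have eq: "((\<lambda>(m, n). b (m, n) * z ^ m * w ^ n) has_sum S) UNIV \<longleftrightarrow>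
      ((\<lambda>k. c z w * (case k of (m, n) \<Rightarrow> a (m, n) * z ^ m * w ^ n)) has_sum S) UNIV" for S
  proof (rule has_sum_shift[OF assms(2)])
    fix k :: "nat \<times> nat"
    obtain m n where k: "k = (m, n)" by (cases k)
    have "(case s k of (m, n) \<Rightarrow> b (m, n) * z ^ m * w ^ n) = b (s k) * (z ^ fst (s k) * w ^ snd (s k))"
      by (simp add: case_prod_unfold)
    also have "\<dots> = a (m, n) * (c z w * (z ^ m * w ^ n))"
      by (simp add: k assms(3) mono)
    finally show "(case s k of (m, n) \<Rightarrow> b (m, n) * z ^ m * w ^ n) = c z w * (case k of (m, n) \<Rightarrow> a (m, n) * z ^ m * w ^ n)"
      by (simp add: k mult_ac)
  next
    fix k assume "k \<notin> range s"
    then show "(case k of (m, n) \<Rightarrow> b (m, n) * z ^ m * w ^ n) = 0"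
      using assms(4) by (cases k) auto
  qed
  have "((\<lambda>k. c z w * (case k of (m, n) \<Rightarrow> a (m, n) * z ^ m * w ^ n)) has_sum c z w * f (z, w)) UNIV"
    using assms(1) zw unfolding bidisc_series_def by (intro has_sum_cmult_right) auto
  then show "((\<lambda>(m, n). b (m, n) * z ^ m * w ^ n) has_sum (case (z, w) of (z, w) \<Rightarrow> c z w * f (z, w))) UNIV"
    by (simp add: eq)
qed

lemma hfun_eqI:
  assumes "bidisc_series F (hcoeff f)" "z \<in> unit_disc" "w \<in> unit_disc"
  shows "hfun f (z, w) = F (z, w)"
  using assms bidisc_series_hcoeff[of f] unfolding bidisc_series_def
  by (blast intro: has_sum_unique)

lemma hfun_has_sum:
  assumes "z \<in> unit_disc" "w \<in> unit_disc"
  shows "((\<lambda>(m, n). hcoeff f (m, n) * z ^ m * w ^ n) has_sum hfun f (z, w)) UNIV"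
  using assms bidisc_series_hcoeff[of f] unfolding bidisc_series_def by blast

section \<open>Multiplication by the coordinates and the backward shift\<close>

definition shift_z :: "nat \<times> nat \<Rightarrow> nat \<times> nat" where "shift_z k = (Suc (fst k), snd k)"
definition shift_w :: "nat \<times> nat \<Rightarrow> nat \<times> nat" where "shift_w k = (fst k, Suc (snd k))"

lemma shift_simps: "shift_z (m, n) = (Suc m, n)" "shift_w (m, n) = (m, Suc n)"
  by (simp_all add: shift_z_def shift_w_def)

lemma inj_shift: "inj shift_z" "inj shift_w"
  by (auto simp: inj_on_def shift_z_def shift_w_def prod_eq_iff)

lemma notin_range_shift_z: "(m, n) \<notin> range shift_z \<longleftrightarrow> m = 0"
proof (cases m)
  case (Suc m')
  then have "(m, n) = shift_z (m', n)" by (simp add: shift_z_def)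
  then show ?thesis using Suc by blast
qed (auto simp: shift_z_def)

lemma notin_range_shift_w: "(m, n) \<notin> range shift_w \<longleftrightarrow> n = 0"
proof (cases n)
  case (Suc n')
  then have "(m, n) = shift_w (m, n')" by (simp add: shift_w_def)
  then show ?thesis using Suc by blast
qed (auto simp: shift_w_def)

definition mult_z :: "hardy2 \<Rightarrow> hardy2"
  where "mult_z f = Hser (\<lambda>(m, n). case m of 0 \<Rightarrow> 0 | Suc i \<Rightarrow> hcoeff f (i, n))"

lemma hcoeff_mult_z: "hcoeff (mult_z f) (m, n) = (case m of 0 \<Rightarrow> 0 | Suc i \<Rightarrow> hcoeff f (i, n))"
proof -
  let ?b = "\<lambda>(m, n). case m of 0 \<Rightarrow> 0 | Suc i \<Rightarrow> hcoeff f (i, n)"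
  have "(\<lambda>k. (cmod (?b k))\<^sup>2) summable_on UNIV"
    by (subst summable_on_shift[OF inj_shift(1), of _ "\<lambda>k. (cmod (hcoeff f k))\<^sup>2"])
      (auto simp: square_summable_hcoeff notin_range_shift_z shift_simps)
  then show ?thesis by (simp add: mult_z_def hcoeff_Hser)
qed

lemma hfun_mult_z: "hfun (mult_z f) (z, w) = z * hfun f (z, w)"
proof (cases "z \<in> unit_disc \<and> w \<in> unit_disc")
  case True
  have "bidisc_series (\<lambda>(z, w). z * hfun f (z, w)) (hcoeff (mult_z f))"
    by (rule bidisc_series_shift[OF bidisc_series_hcoeff inj_shift(1)])
      (auto simp: hcoeff_mult_z notin_range_shift_z shift_simps)
  from hfun_eqI[OF this] True show ?thesis by simp
next
  case False
  then show ?thesis by (subst (1 2) hfun_outside) auto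
qed

lemma hcoeff_mult_w: "hcoeff (mult_w f) (m, n) = (case n of 0 \<Rightarrow> 0 | Suc j \<Rightarrow> hcoeff f (m, j))"
proof -
  let ?b = "\<lambda>(m, n). case n of 0 \<Rightarrow> 0 | Suc j \<Rightarrow> hcoeff f (m, j)"
  have "bidisc_series (\<lambda>(z, w). w * hfun f (z, w)) ?b"
    by (rule bidisc_series_shift[OF bidisc_series_hcoeff inj_shift(2)])
      (auto simp: notin_range_shift_w shift_simps)
  then have "hcoeff (mult_w f) = ?b"
    by (intro hcoeff_eqI) (simp add: mult_w.rep_eq)
  then show ?thesis by simp
qed

lemma norm_mult_z: "norm (mult_z f) = norm f"
proof -
  have "(\<Sum>\<^sub>\<infinity>k. (cmod (hcoeff (mult_z f) k))\<^sup>2) = (\<Sum>\<^sub>\<infinity>k. (cmod (hcoeff f k))\<^sup>2)"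
    by (rule infsum_shift[OF inj_shift(1)])
      (auto simp: hcoeff_mult_z notin_range_shift_z shift_simps)
  then show ?thesis by (metis norm_hardy2_square norm_ge_zero power2_eq_imp_eq)
qed

lemma norm_mult_w: "norm (mult_w f) = norm f"
proof -
  have "(\<Sum>\<^sub>\<infinity>k. (cmod (hcoeff (mult_w f) k))\<^sup>2) = (\<Sum>\<^sub>\<infinity>k. (cmod (hcoeff f k))\<^sup>2)"
    by (rule infsum_shift[OF inj_shift(2)])
      (auto simp: hcoeff_mult_w notin_range_shift_w shift_simps)
  then show ?thesis by (metis norm_hardy2_square norm_ge_zero power2_eq_imp_eq)
qed

lemma mult_w_add: "mult_w (f + g) = mult_w f + mult_w g"
  by (rule hardy2_coeff_eqI) (simp add: hcoeff_mult_w hcoeff_add split: nat.split)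

lemma mult_w_diff: "mult_w (f - g) = mult_w f - mult_w g"
  by (rule hardy2_coeff_eqI) (simp add: hcoeff_mult_w hcoeff_diff split: nat.split)

lemma mult_w_cscale: "mult_w (cscale c f) = cscale c (mult_w f)"
  by (rule hardy2_coeff_eqI) (simp add: hcoeff_mult_w hcoeff_cscale split: nat.split)

definition backshift_w :: "hardy2 \<Rightarrow> hardy2"
  where "backshift_w f = Hser (\<lambda>(m, n). hcoeff f (m, Suc n))"

lemma hcoeff_backshift_w: "hcoeff (backshift_w f) (m, n) = hcoeff f (m, Suc n)"
proof -
  have "(\<lambda>k. (cmod (hcoeff f k))\<^sup>2) summable_on range shift_w"
    using square_summable_hcoeff by (rule summable_on_subset_banach) simp
  then have "(\<lambda>k. (cmod (case k of (m, n) \<Rightarrow> hcoeff f (m, Suc n)))\<^sup>2) summable_on UNIV"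
    by (subst (asm) summable_on_reindex[OF inj_shift(2)]) (simp add: o_def case_prod_unfold shift_w_def)
  then show ?thesis by (simp add: backshift_w_def hcoeff_Hser)
qed

lemma backshift_w_diff: "backshift_w (f - g) = backshift_w f - backshift_w g"
  by (rule hardy2_coeff_eqI) (simp add: hcoeff_backshift_w hcoeff_diff)

lemma cinner_mult_w: "cinner (mult_w f) g = cinner f (backshift_w g)"
  unfolding cinner_def
  by (rule infsum_shift[OF inj_shift(2)])
    (auto simp: hcoeff_mult_w hcoeff_backshift_w notin_range_shift_w shift_simps)

definition w_constant_part :: "hardy2 \<Rightarrow> hardy2"
  where "w_constant_part f = Hser (\<lambda>(m, n). if n = 0 then hcoeff f (m, 0) else 0)"

lemma hcoeff_w_constant_part:
  "hcoeff (w_constant_part f) (m, n) = (if n = 0 then hcoeff f (m, 0) else 0)"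
proof -
  have "(\<lambda>k. (cmod (case k of (m :: nat, n :: nat) \<Rightarrow> if n = 0 then hcoeff f (m, 0) else 0))\<^sup>2) summable_on UNIV"
  proof (rule summable_on_comparison_test)
    show "(\<lambda>k. (cmod (hcoeff f k))\<^sup>2) summable_on UNIV" by (rule square_summable_hcoeff)
  qed auto
  then show ?thesis by (simp add: w_constant_part_def hcoeff_Hser)
qed

lemma norm_w_constant_part_le: "norm (w_constant_part f) \<le> norm f"
proof (rule norm_le_coeffI)
  fix k show "cmod (hcoeff (w_constant_part f) k) \<le> cmod (hcoeff f k)"
    by (cases k) (simp add: hcoeff_w_constant_part)
qed

lemma hfun_w_constant_part:
  assumes "z \<in> unit_disc" "w \<in> unit_disc"
  shows "hfun (w_constant_part f) (z, w) = hfun f (z, 0)"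
proof -
  have "bidisc_series (\<lambda>(z, w). hfun f (z, 0)) (hcoeff (w_constant_part f))"
    unfolding bidisc_series_def
  proof (intro ballI)
    fix z w :: complex assume "z \<in> unit_disc" "w \<in> unit_disc"
    \<comment> \<open>Since \<open>0 ^ 0 = 1\<close>, the powers of 0 select exactly the terms with
      \<open>n = 0\<close>.\<close>
    have "(\<lambda>(m, n). hcoeff (w_constant_part f) (m, n) * z ^ m * w ^ n) =
        (\<lambda>(m, n). hcoeff f (m, n) * z ^ m * 0 ^ n)"
      by (auto simp: hcoeff_w_constant_part fun_eq_iff)
    then show "((\<lambda>(m, n). hcoeff (w_constant_part f) (m, n) * z ^ m * w ^ n) has_sum
        (case (z, w) of (z, w) \<Rightarrow> hfun f (z, 0))) UNIV"
      using hfun_has_sum[of z 0 f] \<open>z \<in> unit_disc\<close> by simp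
  qed
  from hfun_eqI[OF this] assms show ?thesis by simp
qed

lemma mult_w_backshift_w: "mult_w (backshift_w f) = f - w_constant_part f"
  by (rule hardy2_coeff_eqI)
    (simp add: hcoeff_mult_w hcoeff_backshift_w hcoeff_diff hcoeff_w_constant_part split: nat.split)

lemma norm_backshift_w_le: "norm (backshift_w f) \<le> norm f"
proof -
  have "norm (mult_w (backshift_w f)) \<le> norm f"
  proof (rule norm_le_coeffI)
    fix k show "cmod (hcoeff (mult_w (backshift_w f)) k) \<le> cmod (hcoeff f k)"
      by (cases k) (simp add: mult_w_backshift_w hcoeff_diff hcoeff_w_constant_part)
  qed
  then show ?thesis by (simp add: norm_mult_w)
qed

text \<open>The backward shift does not increase norms, so for |\<alpha>| < 1 the right-hand side is
  a contraction in \<open>u\<close> and has a fixed point.\<close>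

lemma resolvent_backshift_w:
  assumes "cmod \<alpha> < 1"
  shows "\<exists>u. u = f + cscale \<alpha> (backshift_w u)"
proof -
  have "dist (f + cscale \<alpha> (backshift_w u)) (f + cscale \<alpha> (backshift_w v)) \<le> cmod \<alpha> * dist u v" for u v
  proof -
    have "dist (f + cscale \<alpha> (backshift_w u)) (f + cscale \<alpha> (backshift_w v)) =
        norm (cscale \<alpha> (backshift_w (u - v)))"
      by (simp add: dist_norm cscale_diff backshift_w_diff)
    also have "\<dots> \<le> cmod \<alpha> * norm (u - v)"
      unfolding norm_cscale by (intro mult_left_mono norm_backshift_w_le) simp
    finally show ?thesis by (simp add: dist_norm)
  qed
  then have "\<exists>!u. f + cscale \<alpha> (backshift_w u) = u"
    using assms by (intro banach_fix_type[of "cmod \<alpha>"]) auto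
  then show ?thesis by metis
qed

text \<open>With \<open>B\<close> the backward shift and \<open>u = (1 - \<alpha> B)\<^sup>-\<^sup>1 f\<close>, the quotient is \<open>B u\<close> and the
  slice is the part of \<open>u\<close> that is constant in \<open>w\<close>.\<close>

lemma slice_division:
  assumes "cmod \<alpha> < 1"
  obtains g s where "f = mult_w g - cscale \<alpha> g + s" "norm s \<le> norm f / (1 - cmod \<alpha>)"
    "\<And>z w. z \<in> unit_disc \<Longrightarrow> w \<in> unit_disc \<Longrightarrow> hfun s (z, w) = hfun f (z, \<alpha>)"
proof -
  obtain u where u: "u = f + cscale \<alpha> (backshift_w u)"
    using resolvent_backshift_w[OF assms] by blast
  define g s where "g = backshift_w u" and "s = w_constant_part u"
  have "u = f + cscale \<alpha> g" unfolding g_def by (rule u)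
  then have f: "f = u - cscale \<alpha> g" by (simp add: eq_diff_eq)
  have wg: "mult_w g = u - s" by (simp add: g_def s_def mult_w_backshift_w)
  have eq: "f = mult_w g - cscale \<alpha> g + s" unfolding wg by (subst f) simp
  have "norm u \<le> norm f + cmod \<alpha> * norm g"
    using norm_triangle_ineq[of f "cscale \<alpha> g"] \<open>u = f + cscale \<alpha> g\<close> by (simp add: norm_cscale)
  also have "\<dots> \<le> norm f + cmod \<alpha> * norm u"
    unfolding g_def by (intro add_left_mono mult_left_mono norm_backshift_w_le) simp
  finally have "norm u * (1 - cmod \<alpha>) \<le> norm f" by (simp add: algebra_simps)
  then have "norm u \<le> norm f / (1 - cmod \<alpha>)"
    using assms by (simp add: pos_le_divide_eq)
  then have le: "norm s \<le> norm f / (1 - cmod \<alpha>)"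
    using norm_w_constant_part_le[of u] by (simp add: s_def)
  have val: "hfun s (z, w) = hfun f (z, \<alpha>)" if "z \<in> unit_disc" "w \<in> unit_disc" for z w
  proof -
    \<comment> \<open>At \<open>w = \<alpha>\<close> the two terms with \<open>g\<close> cancel; as
      \<open>s\<close> is constant in \<open>w\<close>, the value at \<alpha> is its value
      everywhere.\<close>
    have "hfun f (z, \<alpha>) = hfun s (z, \<alpha>)"
      by (subst eq) (simp add: hfun_add hfun_diff hfun_mult_w hfun_cscale)
    then show ?thesis using that assms by (simp add: s_def hfun_w_constant_part)
  qed
  show ?thesis using that[OF eq le val] .
qed

text \<open>Collecting the double series by powers of \<open>w\<close> gives a power series in
  \<open>w\<close> alone. Holomorphy is needed for the maximum principle and for filling in values
  at \<open>w = \<alpha>\<close>.\<close>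

lemma hfun_holomorphic_snd:
  assumes z: "z \<in> unit_disc"
  shows "(\<lambda>w. hfun f (z, w)) holomorphic_on unit_disc"
proof -
  have summ: "(\<lambda>m. hcoeff f (m, n) * z ^ m) summable_on UNIV" for n
  proof -
    \<comment> \<open>The point \<open>w = 1 / 2\<close> serves only as a nonzero point of the disc:
      the fixed factor \<open>(1 / 2) ^ n\<close> can be divided out afterwards.\<close>
    have "(\<lambda>(n, m). hcoeff f (m, n) * z ^ m * (1 / 2) ^ n) summable_on UNIV \<times> UNIV"
      using hfun_has_sum[OF z, of "1 / 2" f]
        has_sum_swap[of "\<lambda>(m, n). hcoeff f (m, n) * z ^ m * (1 / 2) ^ n" UNIV UNIV]
      by (auto simp: summable_on_def)
    from summable_on_SigmaD1[OF this, of n]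
    have "(\<lambda>m. hcoeff f (m, n) * z ^ m * (1 / 2) ^ n) summable_on UNIV" by simp
    from summable_on_cmult_left[OF this, of "2 ^ n"] show ?thesis
      by (simp add: mult.assoc power_mult_distrib[symmetric] del: power_one_over)
  qed
  have "(\<lambda>n. (\<Sum>\<^sub>\<infinity>m. hcoeff f (m, n) * z ^ m) * (w - 0) ^ n) sums hfun f (z, w)" if w: "w \<in> unit_disc" for w
  proof -
    have "((\<lambda>n. (\<Sum>\<^sub>\<infinity>m. hcoeff f (m, n) * z ^ m) * w ^ n) has_sum hfun f (z, w)) UNIV"
    proof (rule has_sum_SigmaD)
      show "((\<lambda>(n, m). hcoeff f (m, n) * z ^ m * w ^ n) has_sum hfun f (z, w)) (SIGMA n:UNIV. UNIV)"
        using hfun_has_sum[OF z w, of f]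
          has_sum_swap[of "\<lambda>(m, n). hcoeff f (m, n) * z ^ m * w ^ n" UNIV UNIV] by simp
      show "((\<lambda>m. case (n, m) of (n, m) \<Rightarrow> hcoeff f (m, n) * z ^ m * w ^ n) has_sum
          (\<Sum>\<^sub>\<infinity>m. hcoeff f (m, n) * z ^ m) * w ^ n) UNIV" for n
        using has_sum_cmult_left[OF has_sum_infsum[OF summ[of n]], of "w ^ n"] by simp
    qed
    then show ?thesis by (simp add: has_sum_imp_sums)
  qed
  then show ?thesis by (rule power_series_holomorphic)
qed

lemma tendsto_mult_w:
  assumes "(f \<longlongrightarrow> l) F"
  shows "((\<lambda>x. mult_w (f x)) \<longlongrightarrow> mult_w l) F"
proof (rule LIM_zero_cancel, rule Lim_null_comparison)
  show "\<forall>\<^sub>F x in F. norm (mult_w (f x) - mult_w l) \<le> norm (f x - l)"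
    by (simp add: mult_w_diff[symmetric] norm_mult_w)
  show "((\<lambda>x. norm (f x - l)) \<longlongrightarrow> 0) F"
    using assms by (intro tendsto_norm_zero LIM_zero)
qed

text \<open>Multiplication by \<open>w\<close> is isometric, so subtracting \<alpha> times
  \<open>f\<close> reduces the norm by at most |\<alpha>| times that of \<open>f\<close>.\<close>

lemma norm_mult_w_minus_ge: "(1 - cmod \<alpha>) * norm f \<le> norm (mult_w f - cscale \<alpha> f)"
  using norm_triangle_ineq2[of "mult_w f" "cscale \<alpha> f"]
  by (simp add: norm_mult_w norm_cscale algebra_simps)

lemma norm_mult_z_minus_ge: "(1 - cmod \<alpha>) * norm f \<le> norm (mult_z f - cscale \<alpha> f)"
  using norm_triangle_ineq2[of "mult_z f" "cscale \<alpha> f"]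
  by (simp add: norm_mult_z norm_cscale algebra_simps)

lemma summable_on_first_column:
  "(\<lambda>m. (cmod (hcoeff s (m, 0)))\<^sup>2) summable_on UNIV"
  and infsum_first_column_le: "(\<Sum>\<^sub>\<infinity>m. (cmod (hcoeff s (m, 0)))\<^sup>2) \<le> (norm s)\<^sup>2"
proof -
  have inj: "inj (\<lambda>m :: nat. (m, 0 :: nat))" by (auto simp: inj_on_def)
  have *: "(\<lambda>k. (cmod (hcoeff s k))\<^sup>2) summable_on range (\<lambda>m. (m, 0))"
    using square_summable_hcoeff by (rule summable_on_subset_banach) simp
  then show "(\<lambda>m. (cmod (hcoeff s (m, 0)))\<^sup>2) summable_on UNIV"
    by (subst (asm) summable_on_reindex[OF inj]) (simp add: o_def)
  have "(\<Sum>\<^sub>\<infinity>k\<in>range (\<lambda>m. (m, 0)). (cmod (hcoeff s k))\<^sup>2) \<le> (norm s)\<^sup>2"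
    unfolding norm_hardy2_square by (intro infsum_mono2 * square_summable_hcoeff) auto
  then show "(\<Sum>\<^sub>\<infinity>m. (cmod (hcoeff s (m, 0)))\<^sup>2) \<le> (norm s)\<^sup>2"
    by (subst (asm) infsum_reindex[OF inj]) (simp add: o_def)
qed

lemma hfun_zero_has_sum:
  assumes "z \<in> unit_disc"
  shows "((\<lambda>m. hcoeff f (m, 0) * z ^ m) has_sum hfun f (z, 0)) UNIV"
proof (rule has_sum_SigmaD)
  show "((\<lambda>(m, n). hcoeff f (m, n) * z ^ m * 0 ^ n) has_sum hfun f (z, 0)) (SIGMA m:UNIV. UNIV)"
    using hfun_has_sum[OF assms, of 0 f] by simp
  show "((\<lambda>n. case (m, n) of (m, n) \<Rightarrow> hcoeff f (m, n) * z ^ m * 0 ^ n) has_sum hcoeff f (m, 0) * z ^ m) UNIV" for m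
    by (rule has_sum_finite_neutralI[of "{0}"]) auto
qed

section \<open>Bounded functions and their quotients\<close>

lemma Hinf_iff: "h \<in> Hinf \<longleftrightarrow> (\<exists>B. \<forall>p. cmod (hfun h p) \<le> B)"
  by (auto simp: Hinf_def bounded_iff)

lemma csubspace_Hinf: "csubspace Hinf"
  unfolding csubspace_def
proof (intro conjI ballI allI)
  show "0 \<in> Hinf" by (auto simp: Hinf_iff hfun_zero)
  fix f assume f: "f \<in> Hinf"
  then obtain B where B: "\<And>p. cmod (hfun f p) \<le> B" by (auto simp: Hinf_iff)
  have "cmod (hfun (cscale c f) p) \<le> cmod c * B" for p c
    unfolding hfun_cscale norm_mult by (intro mult_left_mono B) simp
  then show "cscale c f \<in> Hinf" for c by (auto simp: Hinf_iff)
  fix g assume "g \<in> Hinf"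
  then obtain C where C: "\<And>p. cmod (hfun g p) \<le> C" by (auto simp: Hinf_iff)
  have "cmod (hfun (f + g) p) \<le> B + C" for p
    unfolding hfun_add by (rule norm_triangle_le) (intro add_mono B C)
  then show "f + g \<in> Hinf" by (auto simp: Hinf_iff)
qed

lemma mult_w_Hinf:
  assumes "h \<in> Hinf"
  shows "mult_w h \<in> Hinf"
proof -
  obtain B where B: "\<And>p. cmod (hfun h p) \<le> B" using assms by (auto simp: Hinf_iff)
  have "cmod (hfun (mult_w h) (z, w)) \<le> 1 * B" for z w
  proof (cases "(z, w) \<in> unit_disc \<times> unit_disc")
    case True
    then show ?thesis unfolding hfun_mult_w norm_mult using B by (intro mult_mono) auto
  next
    case False
    then have "hfun (mult_w h) (z, w) = 0" by (rule hfun_outside)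
    then show ?thesis using order_trans[OF norm_ge_zero B] by simp
  qed
  then show ?thesis by (auto simp: Hinf_iff)
qed

text \<open>The quotient has no pole at \<open>w = \<alpha>\<close>, so by the maximum principle it is bounded there
  by its values on a small circle around \<open>\<alpha>\<close>.\<close>

lemma slice_quotient_Hinf:
  assumes h: "h \<in> Hinf" and \<alpha>: "cmod \<alpha> < 1"
    and eq: "h = mult_w g - cscale \<alpha> g + s"
    and s: "\<And>z w. z \<in> unit_disc \<Longrightarrow> w \<in> unit_disc \<Longrightarrow> hfun s (z, w) = hfun h (z, \<alpha>)"
  shows "g \<in> Hinf"
proof -
  obtain B where B: "\<And>p. cmod (hfun h p) \<le> B" using h by (auto simp: Hinf_iff)
  then have "0 \<le> B" using order_trans[OF norm_ge_zero] by blast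
  \<comment> \<open>Half the distance from \<alpha> to the unit circle, so that the closed disc of
    radius \<open>r\<close> about \<alpha> stays inside the open unit disc.\<close>
  define r where "r = (1 - cmod \<alpha>) / 2"
  have r: "0 < r" using \<alpha> by (simp add: r_def)
  have far: "cmod (hfun g (z, w)) \<le> 2 * B / r"
    if zw: "z \<in> unit_disc" "w \<in> unit_disc" "r \<le> cmod (w - \<alpha>)" for z w
  proof -
    have "(w - \<alpha>) * hfun g (z, w) = hfun h (z, w) - hfun h (z, \<alpha>)"
      using s[OF zw(1,2)] arg_cong[OF eq, of "\<lambda>f. hfun f (z, w)"]
      by (simp add: hfun_add hfun_diff hfun_mult_w hfun_cscale algebra_simps)
    then have "cmod (w - \<alpha>) * cmod (hfun g (z, w)) \<le> B + B"
      unfolding norm_mult[symmetric] by (simp only:) (rule norm_triangle_le_diff, intro add_mono B)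
    moreover have "r * cmod (hfun g (z, w)) \<le> cmod (w - \<alpha>) * cmod (hfun g (z, w))"
      using zw(3) by (intro mult_right_mono) auto
    ultimately show ?thesis using r by (simp add: field_simps)
  qed
  have near: "cmod (hfun g (z, w)) \<le> 2 * B / r"
    if z: "z \<in> unit_disc" and w: "w \<in> ball \<alpha> r" for z w
  proof (rule maximum_modulus_frontier[where S = "ball \<alpha> r" and f = "\<lambda>w. hfun g (z, w)"])
    have sub: "cball \<alpha> r \<subseteq> unit_disc"
    proof
      fix x assume "x \<in> cball \<alpha> r"
      then have "cmod (x - \<alpha>) \<le> r" by (simp add: dist_norm norm_minus_commute)
      then have "cmod x \<le> cmod \<alpha> + r" using norm_triangle_sub[of x \<alpha>] by simp
      also have "\<dots> < 1" using \<alpha> by (simp add: r_def field_simps)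
      finally show "x \<in> unit_disc" by simp
    qed
    show "(\<lambda>w. hfun g (z, w)) holomorphic_on interior (ball \<alpha> r)"
      using holomorphic_on_subset[OF hfun_holomorphic_snd[OF z] order_trans[OF ball_subset_cball sub]] by simp
    have "continuous_on (cball \<alpha> r) (\<lambda>w. hfun g (z, w))"
      using sub by (intro holomorphic_on_imp_continuous_on holomorphic_on_subset[OF hfun_holomorphic_snd[OF z]])
    then show "continuous_on (closure (ball \<alpha> r)) (\<lambda>w. hfun g (z, w))"
      using r by simp
    show "cmod (hfun g (z, x)) \<le> 2 * B / r" if "x \<in> frontier (ball \<alpha> r)" for x
    proof (rule far[OF z])
      have "x \<in> sphere \<alpha> r" using that r by simp
      then show "x \<in> unit_disc" "r \<le> cmod (x - \<alpha>)"
        using sub sphere_cball[of \<alpha> r] by (auto simp: dist_norm norm_minus_commute)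
    qed
  qed (use w in auto)
  have "cmod (hfun g (z, w)) \<le> 2 * B / r" for z w
  proof (cases "(z, w) \<in> unit_disc \<times> unit_disc")
    case True
    then show ?thesis using near[of z w] far[of z w]
      by (cases "w \<in> ball \<alpha> r") (auto simp: dist_norm norm_minus_commute)
  next
    case False
    then show ?thesis using \<open>0 \<le> B\<close> r by (simp add: hfun_outside)
  qed
  then show ?thesis by (auto simp: Hinf_iff)
qed

section \<open>The submodule and its complement\<close>

locale H2_symbol =
  fixes \<phi> :: "complex \<Rightarrow> complex" and a :: "nat \<Rightarrow> complex"
  assumes summable_a: "summable (\<lambda>n. (cmod (a n))\<^sup>2)"
    and sums_\<phi>: "\<And>w. w \<in> unit_disc \<Longrightarrow> (\<lambda>n. a n * w ^ n) sums \<phi> w"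
begin

lemma square_summable_a: "(\<lambda>n. (cmod (a n))\<^sup>2) summable_on UNIV"
  using summable_a by (simp add: summable_on_UNIV_nonneg_real_iff)

text \<open>Cauchy-Schwarz against the powers of \<open>w\<close> upgrades ordered convergence to
  unconditional convergence, the form used when double series are rearranged.\<close>

lemma \<phi>_has_sum:
  assumes "w \<in> unit_disc"
  shows "((\<lambda>n. a n * w ^ n) has_sum \<phi> w) UNIV"
proof -
  have "(cmod w)\<^sup>2 < 1" using assms by (simp add: abs_square_less_1)
  then have "summable (\<lambda>n. ((cmod w)\<^sup>2) ^ n)" by (intro summable_geometric) simp
  then have "(\<lambda>n. (cmod (cnj w ^ n))\<^sup>2) summable_on UNIV"
    by (simp add: summable_on_UNIV_nonneg_real_iff norm_power power_mult[symmetric] mult.commute)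
  from square_summable_inner[OF square_summable_a this]
  have "((\<lambda>n. a n * w ^ n) has_sum infsum (\<lambda>n. a n * w ^ n) UNIV) UNIV" by simp
  moreover from this have "infsum (\<lambda>n. a n * w ^ n) UNIV = \<phi> w"
    using sums_\<phi>[OF assms] has_sum_imp_sums sums_unique2 by blast
  ultimately show ?thesis by simp
qed

lemma \<phi>_holomorphic: "\<phi> holomorphic_on unit_disc"
  by (rule power_series_holomorphic[of 0 1 a]) (use sums_\<phi> in auto)

definition norm_\<phi> :: real
  where "norm_\<phi> = sqrt (\<Sum>\<^sub>\<infinity>n. (cmod (a n))\<^sup>2)"

text \<open>Multiplication by \<open>\<phi>\<close> of the slice at \<open>w = 0\<close> only: the product of \<open>\<phi>\<close> with a function of \<open>z\<close>
  alone is in the space, while \<open>\<phi> f\<close> need not be for general \<open>f\<close>.\<close>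

definition mult_\<phi> :: "hardy2 \<Rightarrow> hardy2"
  where "mult_\<phi> s = Hser (\<lambda>(m, n). hcoeff s (m, 0) * a n)"

lemma norm_\<phi>_nonneg: "0 \<le> norm_\<phi>"
  by (simp add: norm_\<phi>_def infsum_nonneg)

lemma mult_\<phi>_square_has_sum:
  "((\<lambda>k. (cmod (case k of (m, n) \<Rightarrow> hcoeff s (m, 0) * a n))\<^sup>2) has_sum
    (\<Sum>\<^sub>\<infinity>m. (cmod (hcoeff s (m, 0)))\<^sup>2) * (\<Sum>\<^sub>\<infinity>n. (cmod (a n))\<^sup>2)) UNIV"
proof -
  have "((\<lambda>(m, n). (cmod (hcoeff s (m, 0)))\<^sup>2 * (cmod (a n))\<^sup>2) has_sum
      (\<Sum>\<^sub>\<infinity>m. (cmod (hcoeff s (m, 0)))\<^sup>2) * (\<Sum>\<^sub>\<infinity>n. (cmod (a n))\<^sup>2)) UNIV"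
    by (intro has_sum_product_nonneg has_sum_infsum summable_on_first_column square_summable_a) auto
  then show ?thesis by (simp add: case_prod_unfold norm_mult power_mult_distrib)
qed

lemma hcoeff_mult_\<phi>: "hcoeff (mult_\<phi> s) (m, n) = hcoeff s (m, 0) * a n"
proof -
  have "(\<lambda>k. (cmod (case k of (m, n) \<Rightarrow> hcoeff s (m, 0) * a n))\<^sup>2) summable_on UNIV"
    using mult_\<phi>_square_has_sum summable_on_def by blast
  then show ?thesis by (simp add: mult_\<phi>_def hcoeff_Hser)
qed

text \<open>The coefficients of the product are products of a factor in \<open>m\<close> and a
  factor in \<open>n\<close>, so the sum of squares factorises.\<close>

lemma norm_mult_\<phi>_le: "norm (mult_\<phi> s) \<le> norm_\<phi> * norm s"
proof -
  have "(norm (mult_\<phi> s))\<^sup>2 = (\<Sum>\<^sub>\<infinity>k. (cmod (case k of (m, n) \<Rightarrow> hcoeff s (m, 0) * a n))\<^sup>2)"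
    unfolding norm_hardy2_square by (intro infsum_cong) (auto simp: hcoeff_mult_\<phi>)
  also have "\<dots> = (\<Sum>\<^sub>\<infinity>m. (cmod (hcoeff s (m, 0)))\<^sup>2) * (\<Sum>\<^sub>\<infinity>n. (cmod (a n))\<^sup>2)"
    by (rule infsumI[OF mult_\<phi>_square_has_sum])
  also have "\<dots> \<le> (norm s)\<^sup>2 * (\<Sum>\<^sub>\<infinity>n. (cmod (a n))\<^sup>2)"
    by (intro mult_right_mono infsum_first_column_le infsum_nonneg) auto
  also have "\<dots> = (norm_\<phi> * norm s)\<^sup>2"
    by (simp add: norm_\<phi>_def power_mult_distrib infsum_nonneg)
  finally show ?thesis by (rule power2_le_imp_le) (simp add: norm_\<phi>_nonneg)
qed

lemma hfun_mult_\<phi>: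
  assumes "z \<in> unit_disc" "w \<in> unit_disc"
  shows "hfun (mult_\<phi> s) (z, w) = \<phi> w * hfun s (z, 0)"
proof -
  have "((\<lambda>m. hcoeff s (m, 0) * z ^ m * \<phi> w) has_sum hfun (mult_\<phi> s) (z, w)) UNIV"
  proof (rule has_sum_SigmaD)
    show "((\<lambda>(m, n). hcoeff (mult_\<phi> s) (m, n) * z ^ m * w ^ n) has_sum hfun (mult_\<phi> s) (z, w)) (SIGMA m:UNIV. UNIV)"
      using hfun_has_sum[OF assms, of "mult_\<phi> s"] by simp
    fix m
    have "((\<lambda>n. hcoeff s (m, 0) * z ^ m * (a n * w ^ n)) has_sum hcoeff s (m, 0) * z ^ m * \<phi> w) UNIV"
      by (intro has_sum_cmult_right \<phi>_has_sum assms)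
    then show "((\<lambda>n. case (m, n) of (m, n) \<Rightarrow> hcoeff (mult_\<phi> s) (m, n) * z ^ m * w ^ n) has_sum
        hcoeff s (m, 0) * z ^ m * \<phi> w) UNIV"
      by (simp add: hcoeff_mult_\<phi> mult_ac)
  qed
  moreover have "((\<lambda>m. hcoeff s (m, 0) * z ^ m * \<phi> w) has_sum hfun s (z, 0) * \<phi> w) UNIV"
    by (intro has_sum_cmult_left hfun_zero_has_sum assms)
  ultimately show ?thesis by (simp add: has_sum_unique mult.commute)
qed

section \<open>The submodule, its generators and its complement\<close>

definition G_phi :: "hardy2 set"
  where "G_phi = {f. \<exists>h\<in>Hinf. \<forall>z\<in>unit_disc. \<forall>w\<in>unit_disc. hfun f (z, w) = (z - \<phi> w) * hfun h (z, w)}"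

lemma M_phi_eq: "M_phi \<phi> = closure G_phi"
  by (simp add: M_phi_def G_phi_def)

lemma csubspace_G_phi: "csubspace G_phi"
  unfolding csubspace_def
proof (intro conjI ballI allI)
  show "0 \<in> G_phi"
    using csubspaceD(1)[OF csubspace_Hinf] by (auto simp: G_phi_def hfun_zero intro!: bexI[of _ 0])
  fix f assume "f \<in> G_phi"
  then obtain h where h: "h \<in> Hinf" "\<And>z w. z \<in> unit_disc \<Longrightarrow> w \<in> unit_disc \<Longrightarrow> hfun f (z, w) = (z - \<phi> w) * hfun h (z, w)"
    unfolding G_phi_def by blast
  show "cscale c f \<in> G_phi" for c
    using csubspaceD(3)[OF csubspace_Hinf h(1), of c] h(2)
    by (auto simp: G_phi_def hfun_cscale intro!: bexI[of _ "cscale c h"])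
  fix g assume "g \<in> G_phi"
  then obtain k where k: "k \<in> Hinf" "\<And>z w. z \<in> unit_disc \<Longrightarrow> w \<in> unit_disc \<Longrightarrow> hfun g (z, w) = (z - \<phi> w) * hfun k (z, w)"
    unfolding G_phi_def by blast
  show "f + g \<in> G_phi"
    using csubspaceD(2)[OF csubspace_Hinf h(1) k(1)] h(2) k(2)
    by (auto simp: G_phi_def hfun_add distrib_left intro!: bexI[of _ "h + k"])
qed

lemma mult_w_G_phi:
  assumes "f \<in> G_phi"
  shows "mult_w f \<in> G_phi"
proof -
  obtain h where h: "h \<in> Hinf" "\<And>z w. z \<in> unit_disc \<Longrightarrow> w \<in> unit_disc \<Longrightarrow> hfun f (z, w) = (z - \<phi> w) * hfun h (z, w)"
    using assms unfolding G_phi_def by blast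
  show ?thesis
    using mult_w_Hinf[OF h(1)] h(2) by (auto simp: G_phi_def hfun_mult_w intro!: bexI[of _ "mult_w h"])
qed

lemma csubspace_M_phi: "csubspace (M_phi \<phi>)"
  unfolding M_phi_eq by (intro csubspace_closure csubspace_G_phi)

lemma closed_M_phi: "closed (M_phi \<phi>)"
  by (simp add: M_phi_eq)

text \<open>Invariance of the generators passes to the closure because multiplication by
  \<open>w\<close> is continuous.\<close>

lemma mult_w_M_phi:
  assumes "f \<in> M_phi \<phi>"
  shows "mult_w f \<in> M_phi \<phi>"
proof -
  obtain x where x: "\<forall>n. x n \<in> G_phi" "x \<longlonglongrightarrow> f"
    using assms unfolding M_phi_eq closure_sequential by blast
  have "(\<lambda>n. mult_w (x n)) \<longlonglongrightarrow> mult_w f" by (intro tendsto_mult_w x)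
  moreover have "\<forall>n. mult_w (x n) \<in> G_phi" using x(1) mult_w_G_phi by blast
  ultimately show ?thesis unfolding M_phi_eq closure_sequential by (intro exI conjI)
qed

text \<open>By continuity of the inner product, orthogonality to \<open>G_phi\<close> extends to its
  closure, so membership can be tested on the explicit generators.\<close>

lemma N_phi_eq: "N_phi \<phi> = orth_compl G_phi"
proof
  show "N_phi \<phi> \<subseteq> orth_compl G_phi"
    unfolding N_phi_def M_phi_eq orth_compl_def using closure_subset by blast
  show "orth_compl G_phi \<subseteq> N_phi \<phi>"
  proof
    fix f assume f: "f \<in> orth_compl G_phi"
    have "cinner f g = 0" if g: "g \<in> closure G_phi" for g
    proof -
      obtain x where x: "\<forall>n. x n \<in> G_phi" "x \<longlonglongrightarrow> g"
        using g unfolding closure_sequential by blast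
      have "(\<lambda>n. cinner (x n) f) \<longlonglongrightarrow> cinner g f" by (intro tendsto_cinner_left x)
      moreover have "cinner (x n) f = 0" for n using x(1) orth_complD'[OF f] by blast
      ultimately have "cinner g f = 0" by (simp add: LIMSEQ_const_iff)
      then show ?thesis by (metis cinner_commute complex_cnj_zero)
    qed
    then show "f \<in> N_phi \<phi>" by (simp add: N_phi_def M_phi_eq orth_compl_def)
  qed
qed

lemma csubspace_N_phi: "csubspace (N_phi \<phi>)"
  and closed_N_phi: "closed (N_phi \<phi>)"
  unfolding N_phi_def by (rule csubspace_orth_compl closed_orth_compl)+

lemma orth_compl_N_phi: "orth_compl (N_phi \<phi>) = M_phi \<phi>"
  unfolding N_phi_def by (intro orth_compl_orth_compl csubspace_M_phi closed_M_phi)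

text \<open>Dual to the invariance of the submodule under \<open>mult_w\<close>, whose adjoint is
  \<open>backshift_w\<close>.\<close>

lemma backshift_w_N_phi:
  assumes "f \<in> N_phi \<phi>"
  shows "backshift_w f \<in> N_phi \<phi>"
proof -
  have "cinner (backshift_w f) g = 0" if "g \<in> M_phi \<phi>" for g
    using orth_complD'[OF assms[unfolded N_phi_def] mult_w_M_phi[OF that]]
    by (subst cinner_commute) (simp add: cinner_mult_w)
  then show ?thesis by (simp add: N_phi_def orth_compl_def)
qed

end

section \<open>Szego kernels and the adjoint\<close>

lemma cscale_minus_left: "cscale (c - d) f = cscale c f - cscale d f"
  by (rule hardy2.scale_left_diff_distrib)

text \<open>The Taylor expansion of the function of (x, y) given by 1 / ((1 - cnj z x) (1 - cnj w
  y)) for \<open>p = (z, w)\<close> in the bidisc. The conjugates compensate for the conjugation in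
  the second argument of \<open>cinner\<close>, so that pairing with it evaluates at
  \<open>p\<close>.\<close>

definition szego :: "complex \<times> complex \<Rightarrow> hardy2"
  where "szego p = Hser (\<lambda>(m, n). cnj (fst p) ^ m * cnj (snd p) ^ n)"

lemma hcoeff_szego:
  assumes "z \<in> unit_disc" "w \<in> unit_disc"
  shows "hcoeff (szego (z, w)) (m, n) = cnj z ^ m * cnj w ^ n"
  using square_summable_monomials[of "cnj z" "cnj w"] assms by (simp add: szego_def hcoeff_Hser)

lemma cinner_szego:
  assumes "z \<in> unit_disc" "w \<in> unit_disc"
  shows "cinner f (szego (z, w)) = hfun f (z, w)"
proof -
  have "(\<lambda>k. hcoeff f k * cnj (hcoeff (szego (z, w)) k)) = (\<lambda>(m, n). hcoeff f (m, n) * z ^ m * w ^ n)"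
    by (auto simp: fun_eq_iff hcoeff_szego[OF assms])
  then show ?thesis
    using infsumI[OF hfun_has_sum[OF assms, of f]] by (simp add: cinner_def)
qed

lemma szego_nonzero:
  assumes "z \<in> unit_disc" "w \<in> unit_disc"
  shows "szego (z, w) \<noteq> 0"
  using hcoeff_szego[OF assms, of 0 0] by (auto simp: hcoeff_zero)

lemma backshift_w_szego:
  assumes "z \<in> unit_disc" "w \<in> unit_disc"
  shows "backshift_w (szego (z, w)) = cscale (cnj w) (szego (z, w))"
  by (rule hardy2_coeff_eqI) (simp add: hcoeff_backshift_w hcoeff_cscale hcoeff_szego[OF assms])

definition z_monomial :: "nat \<Rightarrow> hardy2"
  where "z_monomial m = Hser (\<lambda>k. if k = (m, 0) then 1 else 0)"

lemma hcoeff_z_monomial: "hcoeff (z_monomial m) k = (if k = (m, 0) then 1 else 0)"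
proof -
  have "((\<lambda>k. (cmod (if k = (m, 0 :: nat) then 1 else 0))\<^sup>2) has_sum 1) UNIV"
    by (rule has_sum_finite_neutralI[of "{(m, 0)}"]) auto
  then show ?thesis
    unfolding z_monomial_def by (subst hcoeff_Hser) (auto simp: summable_on_def)
qed

lemma hfun_z_monomial:
  assumes "z \<in> unit_disc" "w \<in> unit_disc"
  shows "hfun (z_monomial m) (z, w) = z ^ m"
proof -
  have "((\<lambda>(i, j). hcoeff (z_monomial m) (i, j) * z ^ i * w ^ j) has_sum z ^ m) UNIV"
    by (rule has_sum_finite_neutralI[of "{(m, 0)}"]) (auto simp: hcoeff_z_monomial split: if_splits)
  then show ?thesis using hfun_has_sum[OF assms] has_sum_unique by blast
qed

lemma z_monomial_Hinf: "z_monomial m \<in> Hinf"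
proof -
  have "cmod (hfun (z_monomial m) (z, w)) \<le> 1" for z w
  proof (cases "(z, w) \<in> unit_disc \<times> unit_disc")
    case True
    then show ?thesis by (simp add: hfun_z_monomial norm_power power_le_one)
  qed (simp add: hfun_outside)
  then show ?thesis by (auto simp: Hinf_iff)
qed

lemma cinner_z_monomial: "cinner (z_monomial m) f = cnj (hcoeff f (m, 0))"
  unfolding cinner_def
  by (intro infsumI has_sum_finite_neutralI[of "{(m, 0)}"]) (auto simp: hcoeff_z_monomial)

lemma mult_z_z_monomial: "mult_z (z_monomial m) = z_monomial (Suc m)"
  by (rule hardy2_coeff_eqI) (auto simp: hcoeff_mult_z hcoeff_z_monomial split: nat.split)

text \<open>An eigenvector of the backward shift with eigenvalue \<open>cnj \<alpha>\<close> is
  orthogonal to every multiple of \<open>w - \<alpha>\<close>, so pairing with it sees only the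
  slice at \<open>w = \<alpha>\<close>.\<close>

lemma cinner_eigenvector_slice:
  assumes "backshift_w f = cscale (cnj \<alpha>) f" "u = mult_w g - cscale \<alpha> g + s"
  shows "cinner u f = cinner s f"
  by (simp add: assms cinner_add_left cinner_diff_left cinner_mult_w cinner_cscale_left cinner_cscale_right)

lemma mult_w_minus_diff:
  "mult_w (f - g) - cscale \<alpha> (f - g) = (mult_w f - cscale \<alpha> f) - (mult_w g - cscale \<alpha> g)"
  by (simp add: mult_w_diff cscale_diff)

section \<open>The compression, its adjoint and the kernel of the adjoint\<close>

context H2_symbol
begin

text \<open>Available on the whole space because \<open>orth_proj\<close> is defined everywhere; the
  projection is contractive and \<open>mult_w\<close> isometric, whence the constant
  \<open>1 + cmod \<alpha>\<close>.\<close>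

lemma S_w_bounded_linear: "bounded_linear (\<lambda>f. S_w \<phi> f - cscale \<alpha> f)"
proof (rule bounded_linear_intro)
  fix f g :: hardy2 and r :: real
  show "S_w \<phi> (f + g) - cscale \<alpha> (f + g) = S_w \<phi> f - cscale \<alpha> f + (S_w \<phi> g - cscale \<alpha> g)"
    by (simp add: S_w_def mult_w_add orth_proj_add[OF csubspace_N_phi closed_N_phi]
      hardy2.scale_right_distrib)
  show "S_w \<phi> (r *\<^sub>R f) - cscale \<alpha> (r *\<^sub>R f) = r *\<^sub>R (S_w \<phi> f - cscale \<alpha> f)"
    by (simp add: S_w_def scaleR_hardy2_def mult_w_cscale cscale_diff
      orth_proj_cscale[OF csubspace_N_phi closed_N_phi] hardy2.scale_scale mult.commute)
  have "norm (S_w \<phi> f) \<le> norm f"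
    using norm_orth_proj_le[OF csubspace_N_phi closed_N_phi, of "mult_w f"]
    by (simp add: S_w_def norm_mult_w)
  then show "norm (S_w \<phi> f - cscale \<alpha> f) \<le> norm f * (1 + cmod \<alpha>)"
    using norm_triangle_ineq4[of "S_w \<phi> f" "cscale \<alpha> f"] by (simp add: norm_cscale algebra_simps)
qed

lemma S_w_cscale: "S_w \<phi> (cscale c f) - cscale \<alpha> (cscale c f) = cscale c (S_w \<phi> f - cscale \<alpha> f)"
  by (simp add: S_w_def mult_w_cscale cscale_diff orth_proj_cscale[OF csubspace_N_phi closed_N_phi]
    hardy2.scale_scale mult.commute)

lemma S_w_minus_in_N_phi: "f \<in> N_phi \<phi> \<Longrightarrow> S_w \<phi> f - cscale \<alpha> f \<in> N_phi \<phi>"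
  unfolding S_w_def by (intro csubspaceD csubspace_N_phi orth_proj_in closed_N_phi)

lemma bounded_op_on_S_w: "bounded_op_on (N_phi \<phi>) (\<lambda>f. S_w \<phi> f - cscale \<alpha> f)"
  unfolding bounded_op_on_def
proof (intro conjI)
  interpret bounded_linear "\<lambda>f. S_w \<phi> f - cscale \<alpha> f" by (rule S_w_bounded_linear)
  show "\<forall>f\<in>N_phi \<phi>. \<forall>g\<in>N_phi \<phi>. S_w \<phi> (f + g) - cscale \<alpha> (f + g) =
      S_w \<phi> f - cscale \<alpha> f + (S_w \<phi> g - cscale \<alpha> g)"
    by (intro ballI add)
  show "\<exists>K. \<forall>f\<in>N_phi \<phi>. norm (S_w \<phi> f - cscale \<alpha> f) \<le> K * norm f"
    using bounded by (metis mult.commute)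
qed (use S_w_minus_in_N_phi S_w_cscale in auto)

text \<open>What the projection removes from \<open>mult_w f\<close> is orthogonal to
  \<open>g\<close>, so the compression may be replaced by \<open>mult_w\<close> itself inside the
  pairing.\<close>

lemma cinner_S_w:
  assumes "g \<in> N_phi \<phi>"
  shows "cinner (S_w \<phi> f - cscale \<alpha> f) g = cinner f (backshift_w g - cscale (cnj \<alpha>) g)"
proof -
  have "cinner (mult_w f - S_w \<phi> f) g = 0"
    unfolding S_w_def
    by (rule orth_complD[OF orth_proj_diff[OF csubspace_N_phi closed_N_phi] assms])
  then have "cinner (S_w \<phi> f) g = cinner f (backshift_w g)"
    by (simp add: cinner_diff_left cinner_mult_w)
  then show ?thesis
    by (simp add: cinner_diff_left cinner_diff_right cinner_cscale_left cinner_cscale_right)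
qed

lemma adjoint_on_S_w:
  assumes "g \<in> N_phi \<phi>"
  shows "adjoint_on (N_phi \<phi>) (\<lambda>f. S_w \<phi> f - cscale \<alpha> f) g = backshift_w g - cscale (cnj \<alpha>) g"
  unfolding adjoint_on_def
proof (rule the_equality)
  let ?h = "backshift_w g - cscale (cnj \<alpha>) g"
  have h: "?h \<in> N_phi \<phi>"
    by (intro csubspaceD csubspace_N_phi backshift_w_N_phi assms)
  then show "?h \<in> N_phi \<phi> \<and> (\<forall>f\<in>N_phi \<phi>. cinner (S_w \<phi> f - cscale \<alpha> f) g = cinner f ?h)"
    using cinner_S_w[OF assms] by blast
  fix h' assume h': "h' \<in> N_phi \<phi> \<and> (\<forall>f\<in>N_phi \<phi>. cinner (S_w \<phi> f - cscale \<alpha> f) g = cinner f h')"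
  \<comment> \<open>Both candidates represent the same functional on \<open>N_phi \<phi>\<close>;
    testing it on their difference shows that the difference has norm 0.\<close>
  have "h' - ?h \<in> N_phi \<phi>" using csubspaceD(4)[OF csubspace_N_phi _ h] h' by blast
  then have "cinner (h' - ?h) h' = cinner (h' - ?h) ?h" using h' cinner_S_w[OF assms] by metis
  then have "cinner (h' - ?h) (h' - ?h) = 0" by (simp only: cinner_diff_right[of _ h' ?h] diff_self)
  then show "h' = ?h" by (simp only: cinner_self_eq_0 right_minus_eq)
qed

text \<open>Every generator has the factor \<open>z - \<phi> w\<close> and so vanishes at (\<phi>
  \<alpha>, \<alpha>), which lies in the bidisc exactly because \<alpha> is in
  \<open>Omega_phi \<phi>\<close>.\<close>

lemma szego_in_N_phi:
  assumes "\<alpha> \<in> Omega_phi \<phi>"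
  shows "szego (\<phi> \<alpha>, \<alpha>) \<in> N_phi \<phi>"
proof -
  have *: "\<phi> \<alpha> \<in> unit_disc" "\<alpha> \<in> unit_disc" using assms by (auto simp: Omega_phi_def)
  have "cinner (szego (\<phi> \<alpha>, \<alpha>)) g = 0" if "g \<in> G_phi" for g
  proof -
    have "hfun g (\<phi> \<alpha>, \<alpha>) = 0" using that * by (auto simp: G_phi_def)
    then show ?thesis by (subst cinner_commute) (simp add: cinner_szego[OF *])
  qed
  then show ?thesis by (simp add: N_phi_eq orth_compl_def)
qed

lemma eigenvector_eq_szego:
  assumes \<alpha>: "\<alpha> \<in> Omega_phi \<phi>" and f: "f \<in> N_phi \<phi>" and eig: "backshift_w f = cscale (cnj \<alpha>) f"
  shows "f = cscale (hcoeff f (0, 0)) (szego (\<phi> \<alpha>, \<alpha>))"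
proof -
  have disc: "\<phi> \<alpha> \<in> unit_disc" "\<alpha> \<in> unit_disc" using \<alpha> by (auto simp: Omega_phi_def)
  then have \<alpha>1: "cmod \<alpha> < 1" by simp
  have w_step: "hcoeff f (m, Suc n) = cnj \<alpha> * hcoeff f (m, n)" for m n
    using arg_cong[OF eig, of "\<lambda>f. hcoeff f (m, n)"] by (simp add: hcoeff_backshift_w hcoeff_cscale)
  have z_step: "hcoeff f (Suc m, 0) = cnj (\<phi> \<alpha>) * hcoeff f (m, 0)" for m
  proof -
    let ?e = "z_monomial m"
    \<comment> \<open>This is the generator \<open>z - \<phi>\<close> times the bounded function
      \<open>z ^ m\<close>; orthogonality to it links the coefficients at \<open>m\<close> and
      \<open>Suc m\<close>.\<close>
    have "mult_z ?e - mult_\<phi> ?e \<in> G_phi"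
      unfolding G_phi_def using z_monomial_Hinf[of m]
      by (auto simp: hfun_diff hfun_mult_z hfun_mult_\<phi> hfun_z_monomial algebra_simps intro!: bexI[of _ ?e])
    then have "cinner (mult_z ?e - mult_\<phi> ?e) f = 0"
      using f orth_complD' unfolding N_phi_eq by blast
    then have "cinner (z_monomial (Suc m)) f = cinner (mult_\<phi> ?e) f"
      by (simp add: cinner_diff_left mult_z_z_monomial)
    also have "\<dots> = \<phi> \<alpha> * cinner ?e f"
    proof -
      obtain g s where gs: "mult_\<phi> ?e = mult_w g - cscale \<alpha> g + s"
        and s: "\<And>z w. z \<in> unit_disc \<Longrightarrow> w \<in> unit_disc \<Longrightarrow> hfun s (z, w) = hfun (mult_\<phi> ?e) (z, \<alpha>)"
        using slice_division[OF \<alpha>1, of "mult_\<phi> ?e"] by metis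
      \<comment> \<open>The slice of \<phi> times \<open>z ^ m\<close> at
        \<open>w = \<alpha>\<close> is \<open>z ^ m\<close> times the number
        \<open>\<phi> \<alpha>\<close>, and only this slice matters in a pairing with
        \<open>f\<close>.\<close>
      have "s = cscale (\<phi> \<alpha>) ?e"
        by (rule hardy2_eqI) (use disc in \<open>simp add: s hfun_mult_\<phi> hfun_cscale hfun_z_monomial\<close>)
      then show ?thesis
        using cinner_eigenvector_slice[OF eig gs] by (simp add: cinner_cscale_left)
    qed
    finally have "cnj (hcoeff f (Suc m, 0)) = \<phi> \<alpha> * cnj (hcoeff f (m, 0))"
      by (simp add: cinner_z_monomial)
    then show ?thesis by (metis complex_cnj_cnj complex_cnj_mult)
  qed
  have col: "hcoeff f (m, 0) = hcoeff f (0, 0) * cnj (\<phi> \<alpha>) ^ m" for m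
    by (induction m) (simp_all add: z_step)
  have coeffs: "hcoeff f (m, n) = hcoeff f (0, 0) * (cnj (\<phi> \<alpha>) ^ m * cnj \<alpha> ^ n)" for m n
    by (induction n) (simp_all add: w_step col[of m])
  show ?thesis
  proof (rule hardy2_coeff_eqI)
    fix m n
    show "hcoeff f (m, n) = hcoeff (cscale (hcoeff f (0, 0)) (szego (\<phi> \<alpha>, \<alpha>))) (m, n)"
      unfolding hcoeff_cscale hcoeff_szego[OF disc] by (rule coeffs)
  qed
qed

lemma ker_adjoint_S_w:
  assumes "\<alpha> \<in> Omega_phi \<phi>"
  shows "ker_on (N_phi \<phi>) (adjoint_on (N_phi \<phi>) (\<lambda>f. S_w \<phi> f - cscale \<alpha> f)) = hardy2_span {szego (\<phi> \<alpha>, \<alpha>)}"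
proof -
  have *: "\<phi> \<alpha> \<in> unit_disc" "\<alpha> \<in> unit_disc" using assms by (auto simp: Omega_phi_def)
  have "ker_on (N_phi \<phi>) (adjoint_on (N_phi \<phi>) (\<lambda>f. S_w \<phi> f - cscale \<alpha> f)) =
      {f \<in> N_phi \<phi>. backshift_w f = cscale (cnj \<alpha>) f}"
    by (auto simp: ker_on_def adjoint_on_S_w)
  also have "\<dots> = range (\<lambda>c. cscale c (szego (\<phi> \<alpha>, \<alpha>)))"
  proof (intro equalityI subsetI)
    fix f assume "f \<in> range (\<lambda>c. cscale c (szego (\<phi> \<alpha>, \<alpha>)))"
    then obtain c where f: "f = cscale c (szego (\<phi> \<alpha>, \<alpha>))" by blast
    have "backshift_w f = cscale (cnj \<alpha>) f"
      by (rule hardy2_coeff_eqI) (simp add: f hcoeff_backshift_w hcoeff_cscale hcoeff_szego[OF *])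
    moreover have "f \<in> N_phi \<phi>"
      unfolding f by (intro csubspaceD csubspace_N_phi szego_in_N_phi assms)
    ultimately show "f \<in> {f \<in> N_phi \<phi>. backshift_w f = cscale (cnj \<alpha>) f}" by simp
  next
    fix f assume "f \<in> {f \<in> N_phi \<phi>. backshift_w f = cscale (cnj \<alpha>) f}"
    then have "f = cscale (hcoeff f (0, 0)) (szego (\<phi> \<alpha>, \<alpha>))"
      using eigenvector_eq_szego[OF assms] by simp
    then show "f \<in> range (\<lambda>c. cscale c (szego (\<phi> \<alpha>, \<alpha>)))" by (rule range_eqI)
  qed
  also have "\<dots> = hardy2_span {szego (\<phi> \<alpha>, \<alpha>)}" by (rule hardy2.span_singleton[symmetric])
  finally show ?thesis .
qed

section \<open>The lower bound\<close>

text \<open>The factor \<open>w - \<alpha>\<close> cancels directly off \<alpha>; at \<alpha> both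
  sides agree because they are continuous in \<open>w\<close>.\<close>

lemma quotient_in_G_phi:
  assumes \<alpha>: "\<alpha> \<in> unit_disc" and g: "g \<in> Hinf"
    and eq: "\<And>z w. z \<in> unit_disc \<Longrightarrow> w \<in> unit_disc \<Longrightarrow>
      (w - \<alpha>) * hfun G (z, w) = (z - \<phi> w) * ((w - \<alpha>) * hfun g (z, w))"
  shows "G \<in> G_phi"
proof -
  have "hfun G (z, w) = (z - \<phi> w) * hfun g (z, w)" if z: "z \<in> unit_disc" and w: "w \<in> unit_disc" for z w
  proof -
    have off: "hfun G (z, x) = (z - \<phi> x) * hfun g (z, x)" if "x \<in> unit_disc" "x \<noteq> \<alpha>" for x
      using eq[OF z that(1)] that(2) by simp
    show ?thesis
    proof (cases "w = \<alpha>")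
      case True
      have hol: "(\<lambda>x. hfun G (z, x)) holomorphic_on unit_disc"
          "(\<lambda>x. (z - \<phi> x) * hfun g (z, x)) holomorphic_on unit_disc"
        by (intro holomorphic_intros hfun_holomorphic_snd \<phi>_holomorphic z)+
      have lim: "(f \<longlongrightarrow> f \<alpha>) (at \<alpha>)" if "f holomorphic_on unit_disc" for f :: "complex \<Rightarrow> complex"
        using that \<alpha> by (metis at_within_open continuous_on holomorphic_on_imp_continuous_on open_ball)
      have "\<forall>\<^sub>F x in at \<alpha>. hfun G (z, x) = (z - \<phi> x) * hfun g (z, x)"
        unfolding eventually_at_topological using \<alpha> off by (intro exI[of _ unit_disc]) auto
      from tendsto_cong[OF this] lim[OF hol(1)] lim[OF hol(2)]
      have "hfun G (z, \<alpha>) = (z - \<phi> \<alpha>) * hfun g (z, \<alpha>)"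
        by (intro tendsto_unique[of "at \<alpha>"]) auto
      then show ?thesis using True by simp
    qed (use off w in simp)
  qed
  then show ?thesis unfolding G_phi_def using g by blast
qed

text \<open>\<open>F = (z - \<phi>) h\<close> and \<open>D = (w - \<alpha>) f - F\<close> have opposite slices at \<open>w = \<alpha>\<close>, so the slice \<open>s\<close> of
  \<open>h\<close> is bounded by \<open>D\<close>, because \<open>z - \<phi> \<alpha>\<close> is bounded below.  Dividing \<open>F - (z - \<phi>) s\<close> by \<open>w - \<alpha>\<close>
  gives an element of the submodule that is close to \<open>f\<close>.\<close>

lemma G_phi_division_bound:
  assumes \<alpha>: "\<alpha> \<in> Omega_phi \<phi>" and F: "F \<in> G_phi"
  obtains G where "G \<in> G_phi"
    "(1 - cmod \<alpha>) * norm (f - G) \<le>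
      (1 + (1 + norm_\<phi>) / ((1 - cmod (\<phi> \<alpha>)) * (1 - cmod \<alpha>))) * norm (mult_w f - cscale \<alpha> f - F)"
proof -
  have disc: "\<phi> \<alpha> \<in> unit_disc" "\<alpha> \<in> unit_disc" using \<alpha> by (auto simp: Omega_phi_def)
  then have \<alpha>1: "cmod \<alpha> < 1" and \<phi>1: "cmod (\<phi> \<alpha>) < 1" by simp_all
  obtain h where h: "h \<in> Hinf"
    and Fh: "\<And>z w. z \<in> unit_disc \<Longrightarrow> w \<in> unit_disc \<Longrightarrow> hfun F (z, w) = (z - \<phi> w) * hfun h (z, w)"
    using F unfolding G_phi_def by blast
  define D where "D = mult_w f - cscale \<alpha> f - F"
  obtain gD sD where sD_le: "norm sD \<le> norm D / (1 - cmod \<alpha>)"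
    and sD: "\<And>z w. z \<in> unit_disc \<Longrightarrow> w \<in> unit_disc \<Longrightarrow> hfun sD (z, w) = hfun D (z, \<alpha>)"
    using slice_division[OF \<alpha>1, of D] by metis
  obtain g s where gs: "h = mult_w g - cscale \<alpha> g + s"
    and s: "\<And>z w. z \<in> unit_disc \<Longrightarrow> w \<in> unit_disc \<Longrightarrow> hfun s (z, w) = hfun h (z, \<alpha>)"
    using slice_division[OF \<alpha>1, of h] by metis
  \<comment> \<open>As \<open>s\<close> is constant in \<open>w\<close>,
    \<open>mult_\<phi> s\<close> is the true product of \<phi> and \<open>s\<close>, so
    \<open>P\<close> is \<open>z - \<phi>\<close> times \<open>s\<close>.\<close>
  define P where "P = mult_z s - mult_\<phi> s"
  have hP: "hfun P (z, w) = (z - \<phi> w) * hfun h (z, \<alpha>)" if "z \<in> unit_disc" "w \<in> unit_disc" for z w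
    using that by (simp add: P_def hfun_diff hfun_mult_z hfun_mult_\<phi> s left_diff_distrib)
  \<comment> \<open>At \<open>w = \<alpha>\<close> the term \<open>(w - \<alpha>) f\<close> drops
    out of \<open>D\<close>, leaving minus the slice of \<open>F\<close>.\<close>
  have "mult_z s - cscale (\<phi> \<alpha>) s = - sD"
    by (rule hardy2_eqI)
      (use disc in \<open>simp add: hfun_diff hfun_add hfun_mult_z hfun_cscale hfun_uminus s sD D_def hfun_mult_w Fh algebra_simps\<close>)
  then have "(1 - cmod (\<phi> \<alpha>)) * norm s \<le> norm sD"
    using norm_mult_z_minus_ge[of "\<phi> \<alpha>" s] by simp
  also have "\<dots> \<le> norm D / (1 - cmod \<alpha>)" by (rule sD_le)
  finally have "norm s * ((1 - cmod (\<phi> \<alpha>)) * (1 - cmod \<alpha>)) \<le> norm D"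
    using \<alpha>1 by (simp add: pos_le_divide_eq mult_ac)
  then have s_le: "norm s \<le> norm D / ((1 - cmod (\<phi> \<alpha>)) * (1 - cmod \<alpha>))"
    using \<alpha>1 \<phi>1 by (subst pos_le_divide_eq) simp_all
  have "norm P \<le> norm s + norm_\<phi> * norm s"
    using norm_triangle_ineq4[of "mult_z s" "mult_\<phi> s"] norm_mult_\<phi>_le[of s]
    by (simp add: P_def norm_mult_z)
  also have "\<dots> = (1 + norm_\<phi>) * norm s" by (simp add: algebra_simps)
  also have "\<dots> \<le> (1 + norm_\<phi>) * (norm D / ((1 - cmod (\<phi> \<alpha>)) * (1 - cmod \<alpha>)))"
    using norm_\<phi>_nonneg by (intro mult_left_mono s_le) simp
  finally have P_le: "norm P \<le> (1 + norm_\<phi>) / ((1 - cmod (\<phi> \<alpha>)) * (1 - cmod \<alpha>)) * norm D" by simp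
  obtain G s' where G: "F - P = mult_w G - cscale \<alpha> G + s'"
    and s': "\<And>z w. z \<in> unit_disc \<Longrightarrow> w \<in> unit_disc \<Longrightarrow> hfun s' (z, w) = hfun (F - P) (z, \<alpha>)"
    using slice_division[OF \<alpha>1, of "F - P"] by metis
  \<comment> \<open>\<open>F\<close> and \<open>P\<close> have the same slice at
    \<open>w = \<alpha>\<close>, so the division by \<open>w - \<alpha>\<close> leaves no
    remainder.\<close>
  have "s' = 0"
    by (rule hardy2_eqI) (use disc in \<open>simp add: s' hfun_diff Fh hP hfun_zero\<close>)
  with G have G: "F - P = mult_w G - cscale \<alpha> G" by simp
  have "G \<in> G_phi"
  proof (rule quotient_in_G_phi[OF disc(2)])
    show "g \<in> Hinf" using slice_quotient_Hinf[OF h \<alpha>1 gs s] .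
    fix z w :: complex assume zw: "z \<in> unit_disc" "w \<in> unit_disc"
    have "(w - \<alpha>) * hfun G (z, w) = hfun (F - P) (z, w)"
      unfolding G by (simp add: hfun_diff hfun_mult_w hfun_cscale left_diff_distrib)
    also have "\<dots> = (z - \<phi> w) * (hfun h (z, w) - hfun s (z, w))"
      using zw by (simp add: hfun_diff Fh hP s right_diff_distrib)
    also have "hfun h (z, w) - hfun s (z, w) = (w - \<alpha>) * hfun g (z, w)"
      by (subst gs) (simp add: hfun_add hfun_diff hfun_mult_w hfun_cscale left_diff_distrib)
    finally show "(w - \<alpha>) * hfun G (z, w) = (z - \<phi> w) * ((w - \<alpha>) * hfun g (z, w))" .
  qed
  moreover have "(1 - cmod \<alpha>) * norm (f - G) \<le> norm (D + P)"
  proof -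
    \<comment> \<open>\<open>w - \<alpha>\<close> times \<open>G\<close> is \<open>F - P\<close>,
      and \<open>D\<close> is \<open>w - \<alpha>\<close> times \<open>f\<close> minus
      \<open>F\<close>.\<close>
    have "mult_w (f - G) - cscale \<alpha> (f - G) = D + P"
      unfolding mult_w_minus_diff G[symmetric] D_def by simp
    then show ?thesis using norm_mult_w_minus_ge[of \<alpha> "f - G"] by simp
  qed
  then have "(1 - cmod \<alpha>) * norm (f - G) \<le>
      (1 + (1 + norm_\<phi>) / ((1 - cmod (\<phi> \<alpha>)) * (1 - cmod \<alpha>))) * norm D"
    using norm_triangle_ineq[of D P] P_le by (simp add: algebra_simps)
  ultimately show ?thesis using that unfolding D_def by blast
qed

text \<open>The division bound holds for every generator \<open>F\<close>; by continuity it extends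
  to the element of the submodule that the projection removes from \<open>mult_w f\<close>.\<close>

lemma S_w_bounded_below:
  assumes \<alpha>: "\<alpha> \<in> Omega_phi \<phi>"
  obtains e where "0 < e" "\<And>f. f \<in> N_phi \<phi> \<Longrightarrow> e * norm f \<le> norm (S_w \<phi> f - cscale \<alpha> f)"
proof -
  have \<alpha>1: "cmod \<alpha> < 1" and \<phi>1: "cmod (\<phi> \<alpha>) < 1" using \<alpha> by (auto simp: Omega_phi_def)
  define C where "C = 1 + (1 + norm_\<phi>) / ((1 - cmod (\<phi> \<alpha>)) * (1 - cmod \<alpha>))"
  have C: "0 < C"
    using \<alpha>1 \<phi>1 norm_\<phi>_nonneg by (auto simp: C_def intro!: add_pos_nonneg divide_nonneg_pos)
  have "(1 - cmod \<alpha>) / C * norm f \<le> norm (S_w \<phi> f - cscale \<alpha> f)" if f: "f \<in> N_phi \<phi>" for f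
  proof -
    have G_bound: "(1 - cmod \<alpha>) * norm f \<le> C * norm (mult_w f - cscale \<alpha> f - F)" if F: "F \<in> G_phi" for F
    proof -
      obtain G where G: "G \<in> G_phi"
        and le: "(1 - cmod \<alpha>) * norm (f - G) \<le> C * norm (mult_w f - cscale \<alpha> f - F)"
        using G_phi_division_bound[OF \<alpha> F, of f] unfolding C_def by blast
      \<comment> \<open>Orthogonality of \<open>f\<close> to \<open>G\<close> turns closeness of
        \<open>f\<close> to \<open>G\<close> into smallness of \<open>f\<close>.\<close>
      have "cinner f (0 - G) = 0"
        unfolding cinner_diff_right using orth_complD[OF f[unfolded N_phi_eq] G] by (simp add: cinner_zero)
      then have "norm f \<le> norm (f + (0 - G))" by (rule norm_le_norm_add_orth)
      then have "norm f \<le> norm (f - G)" by simp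
      then have "(1 - cmod \<alpha>) * norm f \<le> (1 - cmod \<alpha>) * norm (f - G)"
        using \<alpha>1 by (intro mult_left_mono) auto
      with le show ?thesis by linarith
    qed
    define F where "F = mult_w f - S_w \<phi> f"
    have "F \<in> M_phi \<phi>"
      using orth_proj_diff[OF csubspace_N_phi closed_N_phi, of "mult_w f"]
      by (simp add: F_def S_w_def orth_compl_N_phi)
    then obtain x where x: "\<forall>n. x n \<in> G_phi" "x \<longlonglongrightarrow> F"
      unfolding M_phi_eq closure_sequential by blast
    have "(1 - cmod \<alpha>) * norm f \<le> C * norm (mult_w f - cscale \<alpha> f - F)"
    proof (rule LIMSEQ_le_const)
      show "(\<lambda>n. C * norm (mult_w f - cscale \<alpha> f - x n)) \<longlonglongrightarrow> C * norm (mult_w f - cscale \<alpha> f - F)"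
        by (intro tendsto_intros x)
    qed (use G_bound x(1) in blast)
    also have "mult_w f - cscale \<alpha> f - F = S_w \<phi> f - cscale \<alpha> f"
      by (simp add: F_def)
    finally show ?thesis using C by (simp add: field_simps)
  qed
  then show ?thesis using that[of "(1 - cmod \<alpha>) / C"] C \<alpha>1 by simp
qed

section \<open>Kernel, closed range, index and spectrum\<close>

lemma ker_S_w:
  assumes "\<alpha> \<in> Omega_phi \<phi>"
  shows "ker_on (N_phi \<phi>) (\<lambda>f. S_w \<phi> f - cscale \<alpha> f) = {0}"
proof -
  interpret bounded_linear "\<lambda>f. S_w \<phi> f - cscale \<alpha> f" by (rule S_w_bounded_linear)
  obtain e where e: "0 < e" "\<And>f. f \<in> N_phi \<phi> \<Longrightarrow> e * norm f \<le> norm (S_w \<phi> f - cscale \<alpha> f)"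
    using S_w_bounded_below[OF assms] by blast
  have "f = 0" if "f \<in> N_phi \<phi>" "S_w \<phi> f - cscale \<alpha> f = 0" for f
    using e(2)[OF that(1)] e(1) that(2) by (simp add: mult_le_0_iff)
  moreover have "0 \<in> N_phi \<phi>" by (rule csubspaceD(1)[OF csubspace_N_phi])
  ultimately show ?thesis using zero unfolding ker_on_def by blast
qed

lemma fredholm_S_w:
  assumes "\<alpha> \<in> Omega_phi \<phi>"
  shows "fredholm_on (N_phi \<phi>) (\<lambda>f. S_w \<phi> f - cscale \<alpha> f)"
proof -
  obtain e where e: "0 < e" "\<And>f. f \<in> N_phi \<phi> \<Longrightarrow> e * norm f \<le> norm (S_w \<phi> f - cscale \<alpha> f)"
    using S_w_bounded_below[OF assms] by blast
  \<comment> \<open>An operator that is bounded below maps a complete subspace onto a complete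
    set.\<close>
  have "complete ((\<lambda>f. S_w \<phi> f - cscale \<alpha> f) ` N_phi \<phi>)"
    using e by (intro complete_isometric_image[OF e(1)] csubspace_imp_subspace csubspace_N_phi
      S_w_bounded_linear) (auto simp: complete_eq_closed closed_N_phi)
  then have "closed ((\<lambda>f. S_w \<phi> f - cscale \<alpha> f) ` N_phi \<phi>)" by (simp add: complete_eq_closed)
  moreover have "finite_dim {0}"
    unfolding finite_dim_def by (intro exI[of _ "{}"]) (simp add: hardy2.span_empty)
  moreover have "finite_dim (hardy2_span {szego (\<phi> \<alpha>, \<alpha>)})"
    unfolding finite_dim_def by blast
  ultimately show ?thesis
    unfolding fredholm_on_def ker_S_w[OF assms] ker_adjoint_S_w[OF assms]
    using bounded_op_on_S_w by blast
qed

lemma index_S_w: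
  assumes "\<alpha> \<in> Omega_phi \<phi>"
  shows "index_on (N_phi \<phi>) (\<lambda>f. S_w \<phi> f - cscale \<alpha> f) = -1"
proof -
  have "szego (\<phi> \<alpha>, \<alpha>) \<noteq> 0"
    using assms by (intro szego_nonzero) (auto simp: Omega_phi_def)
  then have "hardy2_dim (hardy2_span {szego (\<phi> \<alpha>, \<alpha>)}) = 1"
    by (subst hardy2.dim_span_eq_card_independent) (simp_all add: hardy2.dependent_single)
  moreover have "hardy2_dim {0} = 0"
    using hardy2.dim_span_eq_card_independent[of "{}"] hardy2.span_empty hardy2.independent_empty by simp
  ultimately show ?thesis
    unfolding index_on_def ker_S_w[OF assms] ker_adjoint_S_w[OF assms] by simp
qed

text \<open>A bounded inverse \<open>T\<close> at a limit point \<open>\<alpha>\<close> is refuted by \<open>T k\<close> for the kernel \<open>k\<close> at a nearby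
  point \<open>\<beta>\<close>: since \<open>k\<close> is an eigenvector of the adjoint, \<open>\<parallel>k\<parallel>\<^sup>2 = (\<beta> - \<alpha>) \<langle>T k, k\<rangle>\<close>.\<close>

lemma closure_Omega_subset_spectrum: "closure (Omega_phi \<phi>) \<subseteq> spectrum_on (N_phi \<phi>) (S_w \<phi>)"
proof (intro subsetI)
  fix \<alpha> assume \<alpha>: "\<alpha> \<in> closure (Omega_phi \<phi>)"
  have False if T: "bounded_op_on (N_phi \<phi>) T"
    and inv: "\<And>f. f \<in> N_phi \<phi> \<Longrightarrow> S_w \<phi> (T f) - cscale \<alpha> (T f) = f" for T
  proof -
    obtain K where K: "\<And>f. f \<in> N_phi \<phi> \<Longrightarrow> norm (T f) \<le> K * norm f"
      using T unfolding bounded_op_on_def by blast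
    \<comment> \<open>The constant \<open>K\<close> may be zero or negative;
      \<open>\<bar>K\<bar> + 1\<close> gives a positive radius within which |\<beta> - \<alpha>|
      times \<open>\<bar>K\<bar> + 1\<close> stays below 1.\<close>
    have "0 < 1 / (\<bar>K\<bar> + 1)" by simp
    then obtain \<beta> where \<beta>: "\<beta> \<in> Omega_phi \<phi>" "dist \<beta> \<alpha> < 1 / (\<bar>K\<bar> + 1)"
      using \<alpha> unfolding closure_approachable by blast
    have disc: "\<phi> \<beta> \<in> unit_disc" "\<beta> \<in> unit_disc" using \<beta>(1) by (auto simp: Omega_phi_def)
    define k where "k = szego (\<phi> \<beta>, \<beta>)"
    have k: "k \<in> N_phi \<phi>" unfolding k_def by (rule szego_in_N_phi[OF \<beta>(1)])
    have "backshift_w k - cscale (cnj \<alpha>) k = cscale (cnj (\<beta> - \<alpha>)) k"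
      by (simp add: k_def backshift_w_szego[OF disc] cscale_minus_left)
    then have "cinner k k = (\<beta> - \<alpha>) * cinner (T k) k"
      using cinner_S_w[OF k, of "T k" \<alpha>] inv[OF k] by (simp add: cinner_cscale_right)
    then have "(norm k)\<^sup>2 = cmod (\<beta> - \<alpha>) * cmod (cinner (T k) k)"
      unfolding norm_square_eq_cinner[symmetric] norm_mult[symmetric]
      by (metis norm_of_real abs_of_nonneg zero_le_power2)
    also have "\<dots> \<le> cmod (\<beta> - \<alpha>) * (norm (T k) * norm k)"
      by (intro mult_left_mono norm_cinner_le) simp
    also have "\<dots> \<le> cmod (\<beta> - \<alpha>) * (\<bar>K\<bar> * norm k * norm k)"
    proof (intro mult_left_mono mult_right_mono)
      have "norm (T k) \<le> K * norm k" by (rule K[OF k])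
      also have "\<dots> \<le> \<bar>K\<bar> * norm k" by (intro mult_right_mono) auto
      finally show "norm (T k) \<le> \<bar>K\<bar> * norm k" .
    qed auto
    also have "\<dots> = cmod (\<beta> - \<alpha>) * \<bar>K\<bar> * (norm k)\<^sup>2" by (simp add: power2_eq_square)
    finally have le: "(norm k)\<^sup>2 * 1 \<le> (norm k)\<^sup>2 * (cmod (\<beta> - \<alpha>) * \<bar>K\<bar>)" by (simp add: mult.commute)
    have "0 < (norm k)\<^sup>2" using szego_nonzero[OF disc] by (simp add: k_def)
    with le have "1 \<le> cmod (\<beta> - \<alpha>) * \<bar>K\<bar>" by (simp only: mult_le_cancel_left_pos)
    also have "\<dots> \<le> cmod (\<beta> - \<alpha>) * (\<bar>K\<bar> + 1)" by (intro mult_left_mono) auto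
    also have "\<dots> < 1" using \<beta>(2) by (simp add: dist_norm pos_less_divide_eq)
    finally show False by simp
  qed
  then show "\<alpha> \<in> spectrum_on (N_phi \<phi>) (S_w \<phi>)"
    unfolding spectrum_on_def by blast
qed

end

theorem proposition3p2:
  fixes \<phi> :: "complex \<Rightarrow> complex"
  assumes "\<phi> \<in> H2_disc"
    and "\<exists>w\<in>unit_disc. \<phi> w \<noteq> 0"
    and "\<phi> ` unit_disc \<inter> unit_disc \<noteq> {}"
  shows "closure (Omega_phi \<phi>) \<subseteq> spectrum_on (N_phi \<phi>) (S_w \<phi>) \<and>
         (\<forall>\<alpha>\<in>Omega_phi \<phi>.
           fredholm_on (N_phi \<phi>) (\<lambda>f. S_w \<phi> f - cscale \<alpha> f) \<and>
           index_on (N_phi \<phi>) (\<lambda>f. S_w \<phi> f - cscale \<alpha> f) = -1)"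
proof -
  obtain a where "summable (\<lambda>n. (cmod (a n))\<^sup>2)" "\<forall>w\<in>unit_disc. (\<lambda>n. a n * w ^ n) sums \<phi> w"
    using assms(1) unfolding H2_disc_def by blast
  then interpret H2_symbol \<phi> a by unfold_locales auto
  show ?thesis using closure_Omega_subset_spectrum fredholm_S_w index_S_w by blast
qed

end
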